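(* Let $s\geq 2$ be an integer, $m=2s$, $q=2^m$, let $l$ be an integer with $1\leq l\leq m-1$ and $l\neq s$, and put $d=\gcd(s,l)$, $d'=\gcd(s+l,2l)$. Let $$\overline{\mathcal{C}_2^{\bot}}^{\bot}=\{(\mathrm{Tr}_1^s(ax^{2^s+1})+\mathrm{Tr}_1^m(bx^{2^l+1}+cx)+h)_{x\in\mathbb{F}_q}: a\in\mathbb{F}_{2^s},\ b,c\in\mathbb{F}_q,\ h\in\mathbb{F}_2\}.$$ Then this code has length $2^m$ and dimension $\frac{5m}{2}+1$ over $\mathbb{F}_2$, and its weight distribution is as follows (the number of codewords of any weight not listed is $0$). (1) If $d'=d$: - weight $0$: $1$; - weight $2^{2s-1}-2^{s-1}$ and weight $2^{2s-1}+2^{s-1}$: each $\dfrac{2^{2s}(2^s-1)(2^{2(s+d)}-2^{2s+d}-2^{2s}+2^{s+2d}-2^{s+d}+2^{2d})}{2^{2d}-1}$; - weight $2^{2s-1}-2^{s+d-1}$ and weight $2^{2s-1}+2^{s+d-1}$: each $\dfrac{2^{2(s-d)}(2^{s+d}-1)(2^{2s}-1)}{2^{2d}-1}$; - weight $2^{2s-1}$: $2(2^{3s-d}-2^{2(s-d)}+1)(2^{2s}-1)$; - weight $2^{2s}$: $1$. (2) If $d'=2d$: - weight $0$: $1$; - weight $2^{2s-1}-2^{s-1}$ and weight $2^{2s-1}+2^{s-1}$: each $\dfrac{2^{2s+3d}(2^s-1)(2^{2s}-2^{2(s-d)}-2^{2s-3d}+2^s-2^{s-d}+1)}{(2^{2d}-1)(2^d+1)}$;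 - weight $2^{2s-1}-2^{s+d-1}$ and weight $2^{2s-1}+2^{s+d-1}$: each $\dfrac{2^{2s-d}(2^{2s}-1)(2^s+2^{s-d}+2^{s-2d}+1)}{(2^d+1)^2}$; - weight $2^{2s-1}$: $2(2^{2s}-1)(2^{3s-d}-2^{3s-2d}+2^{3s-3d}-2^{3s-4d}+2^{3s-5d}+2^{2s-d}-2^{2s-2d+1}+2^{2s-3d}-2^{2s-4d}+1)$; - weight $2^{2s-1}-2^{s+2d-1}$ and weight $2^{2s-1}+2^{s+2d-1}$: each $\dfrac{2^{2s-4d}(2^{s-d}-1)(2^{2s}-1)}{(2^d+1)(2^{2d}-1)}$; - weight $2^{2s}$: $1$.
   Context: $\mathbb{F}_q$ is the finite field with $q=2^m$ elements; $\mathrm{Tr}_1^m$ and $\mathrm{Tr}_1^s$ are the trace functions from $\mathbb{F}_{2^m}$ and $\mathbb{F}_{2^s}$, respectively, onto $\mathbb{F}_2$ (note $x^{2^s+1}\in\mathbb{F}_{2^s}$ for $x\in\mathbb{F}_q$). The weight distribution of a code records, for each $i$, the number of codewords of Hamming weight $i$. The notation $\overline{\mathcal{C}_2^{\bot}}^{\bot}$ is just the name of the displayed code (it is the dual of the extended code of the dual of the cyclic code $\mathcal{C}_2$ formed by the vectors $(\mathrm{Tr}_1^s(ax^{2^s+1})+\mathrm{Tr}_1^m(bx^{2^l+1}+cx))_{x\in\mathbb{F}_q^*}$). *)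

theory Defs
  imports
    "HOL-Analysis.Analysis"
    "HOL-Library.Z2"
    "HOL-Computational_Algebra.Computational_Algebra"
begin

text \<open>
  The field with \<open>2^m\<close> elements is a type of class \<^class>\<open>finite_field\<close> with that many elements,
  and the field with two elements is \<^typ>\<open>bit\<close>, embedded into any field by \<^const>\<open>of_bit\<close>.
\<close>

text \<open>
  The subfield with \<open>2^n\<close> elements of a field of characteristic 2, as the set of fixed points of
  the \<open>n\<close>-th power of the Frobenius automorphism (see \<open>card_gf_sub\<close> for the case used here).
\<close>

definition gf_sub :: "nat \<Rightarrow> 'a::finite_field set" where
  "gf_sub n = {x. x ^ (2 ^ n) = x}"

text \<open>
  The absolute trace from the field with \<open>2^n\<close> elements to the field with two elements. For \<open>x\<close> in
  \<^term>\<open>gf_sub n\<close> the sum lies in the prime field, so the description is proper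
  (see \<open>of_bit_abs_trace\<close>); \<^term>\<open>abs_trace n x\<close> is only meaningful for such \<open>x\<close>.
\<close>

definition abs_trace :: "nat \<Rightarrow> 'a::finite_field \<Rightarrow> bit" where
  "abs_trace n x = (THE t. of_bit t = (\<Sum>i<n. x ^ (2 ^ i)))"

text \<open>
  Block codes with coordinates indexed by a finite type \<open>'n\<close>; linear codes are the subspaces
  in the sense of \<^const>\<open>vec.subspace\<close>, with dimension \<^const>\<open>vec.dim\<close>.
\<close>

definition code_length :: "('k ^ 'n::finite) set \<Rightarrow> nat" where
  "code_length C = CARD('n)"

definition hamming_weight :: "'k::zero ^ 'n::finite \<Rightarrow> nat" where
  "hamming_weight v = card {i. v $ i \<noteq> 0}"

definition weight_count :: "('k::zero ^ 'n::finite) set \<Rightarrow> nat \<Rightarrow> nat" where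
  "weight_count C w = card {v \<in> C. hamming_weight v = w}"

definition trace_code :: "nat \<Rightarrow> nat \<Rightarrow> (bit ^ 'a::finite_field) set" where
  "trace_code s l =
     {(\<chi> x. abs_trace s (a * x ^ (2 ^ s + 1))
           + abs_trace (2 * s) (b * x ^ (2 ^ l + 1) + c * x) + h) | a b c h. a \<in> gf_sub s}"


lemma CHAR_eq_2:
  assumes "CARD('a::finite_field) = 2 ^ n"
  shows "CHAR('a) = 2"
proof -
  have "n \<noteq> 0"
  proof
    assume "n = 0"
    hence "card (UNIV :: 'a set) = 1" using assms by simp
    then obtain z where "(UNIV :: 'a set) = {z}" by (rule card_1_singletonE)
    hence "(0 :: 'a) = 1" by (metis UNIV_I singletonD)
    thus False by simp
  qed
  have "(- 1 :: 'a) ^ (2 ^ n) = - 1"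
    using finite_field_power_card_eq_same[of "- 1 :: 'a"] assms by simp
  hence "(1 :: 'a) = - 1" using \<open>n \<noteq> 0\<close> by simp
  hence "(1 :: 'a) + 1 = 0" by (metis add.right_inverse)
  hence "(2 :: 'a) = 0" by simp
  hence "of_nat 2 = (0 :: 'a)" by simp
  hence "CHAR('a) dvd 2" by (simp only: of_nat_eq_0_iff_char_dvd)
  thus ?thesis
    using CHAR_prime[where ?'a = 'a] primes_dvd_imp_eq two_is_prime_nat by blast
qed

lemma power_add_2:
  fixes x y :: "'a::finite_field"
  assumes "CHAR('a) = 2"
  shows "(x + y) ^ (2 ^ n) = x ^ (2 ^ n) + y ^ (2 ^ n)"
  by (rule freshmans_dream') (use assms in auto)

lemma add_self_2:
  fixes x :: "'a::finite_field"
  assumes "CHAR('a) = 2"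
  shows "x + x = 0"
  using of_nat_CHAR[where ?'a = 'a] assms by (simp flip: mult_2)

lemma of_bit_abs_trace:
  fixes x :: "'a::finite_field"
  assumes char: "CHAR('a) = 2" and x: "x \<in> gf_sub n"
  shows "of_bit (abs_trace n x) = (\<Sum>i<n. x ^ (2 ^ i))"
proof -
  let ?S = "\<Sum>i<n. x ^ (2 ^ i)"
  have "?S ^ 2 = (\<Sum>i<n. (x ^ (2 ^ i)) ^ 2)"
    by (rule freshmans_dream_sum) (use char in auto)
  also have "\<dots> = (\<Sum>i<n. x ^ (2 ^ Suc i))"
    by (simp add: power_mult [symmetric] mult.commute)
  also have "\<dots> + x = ?S + x ^ (2 ^ n)"
    using sum.lessThan_Suc_shift[of "\<lambda>i. x ^ (2 ^ i)" n]
          sum.lessThan_Suc[of "\<lambda>i. x ^ (2 ^ i)" n] by (simp add: add.commute)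
  finally have "?S ^ 2 = ?S" using x by (simp add: gf_sub_def)
  hence "?S * (?S - 1) = 0" by (simp add: power2_eq_square algebra_simps)
  hence "?S = 0 \<or> ?S = 1" by simp
  hence "\<exists>!t::bit. of_bit t = ?S"
  proof
    assume "?S = 0" thus ?thesis by (intro ex1I[of _ 0]) (auto split: if_splits)
  next
    assume "?S = 1" thus ?thesis by (intro ex1I[of _ 1]) (auto split: if_splits)
  qed
  from theI'[OF this] show ?thesis by (simp add: abs_trace_def)
qed

lemma gf_sub_closed:
  fixes x y :: "'a::finite_field"
  assumes "CHAR('a) = 2"
  shows "0 \<in> gf_sub n" "1 \<in> (gf_sub n :: 'a set)"
    "x \<in> gf_sub n \<Longrightarrow> y \<in> gf_sub n \<Longrightarrow> x + y \<in> gf_sub n"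
    "x \<in> gf_sub n \<Longrightarrow> y \<in> gf_sub n \<Longrightarrow> x * y \<in> gf_sub n"
    "x \<in> gf_sub n \<Longrightarrow> inverse x \<in> gf_sub n"
  using power_add_2[OF assms] by (auto simp: gf_sub_def power_mult_distrib power_inverse)

lemma gf_sub_UNIV:
  assumes "CARD('a::finite_field) = 2 ^ n"
  shows "gf_sub n = (UNIV :: 'a set)"
  using finite_field_power_card_eq_same[where ?'a = 'a] assms by (auto simp: gf_sub_def)

lemma norm_in_gf_sub:
  fixes x :: "'a::finite_field"
  assumes "CARD('a) = 2 ^ (2 * s)"
  shows "x ^ (2 ^ s + 1) \<in> gf_sub s"
proof -
  have "x ^ (2 ^ s * 2 ^ s) = x"
    using finite_field_power_card_eq_same[of x] assms by (simp add: mult_2 power_add)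
  thus ?thesis by (simp add: gf_sub_def power_mult_distrib mult.commute flip: power_mult)
qed

lemma card_gf_sub:
  assumes card: "CARD('a::finite_field) = 2 ^ (2 * s)" and "s > 0"
  shows "card (gf_sub s :: 'a set) = 2 ^ s"
proof -
  have char: "CHAR('a) = 2" using CHAR_eq_2[OF card] .
  let ?K = "gf_sub s :: 'a set"
  let ?f = "\<lambda>x::'a. x ^ (2 ^ s) + x"
  have s1: "(2::nat) ^ s > 1" using \<open>s > 0\<close> by (intro one_less_power) auto
  have le: "card ?K \<le> 2 ^ s"
  proof -
    define p :: "'a poly" where "p = monom 1 (2 ^ s) - monom 1 1"
    have c: "coeff p (2 ^ s) = 1" using s1 by (simp add: p_def)
    hence p0: "p \<noteq> 0" by auto
    have "degree p \<le> 2 ^ s"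
      unfolding p_def using s1 by (intro degree_diff_le degree_monom_le le_trans[OF degree_monom_le]) auto
    moreover have "?K = {x. poly p x = 0}" by (auto simp: p_def gf_sub_def poly_monom)
    ultimately show ?thesis using card_poly_roots_bound[OF p0] by simp
  qed
  have fK: "?f x \<in> ?K" for x
  proof -
    have "x ^ (2 ^ s * 2 ^ s) = x"
      using finite_field_power_card_eq_same[of x] card by (simp add: mult_2 power_add)
    thus ?thesis using power_add_2[OF char, of "x ^ 2 ^ s" x s]
      by (simp add: gf_sub_def add.commute flip: power_mult)
  qed
  have fib: "card {x. ?f x = y} \<le> card ?K" for y
  proof (cases "\<exists>z. ?f z = y")
    case True
    then obtain z where z: "?f z = y" by blast
    have "(\<lambda>x. x + z) ` {x. ?f x = y} \<subseteq> ?K"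
    proof clarsimp
      fix x assume "y = ?f x"
      hence e: "?f x = ?f z" using z by simp
      have "(x + z) ^ 2 ^ s + (x + z) = ?f x + ?f z"
        using power_add_2[OF char, of x z s] by (simp add: algebra_simps)
      also have "\<dots> = 0" unfolding e by (rule add_self_2[OF char])
      finally have "(x + z) ^ 2 ^ s + (x + z) = (x + z) + (x + z)"
        by (simp only: add_self_2[OF char])
      thus "x + z \<in> gf_sub s" by (simp add: gf_sub_def)
    qed
    from card_mono[OF _ this] show ?thesis by (simp add: card_image)
  qed simp
  have "CARD('a) = card (\<Union>y\<in>?K. {x. ?f x = y})"
    using fK by (intro arg_cong[where f = card]) auto
  also have "\<dots> \<le> (\<Sum>y\<in>?K. card {x. ?f x = y})" by (rule card_UN_le) simp
  also have "\<dots> \<le> card ?K * card ?K" using sum_bounded_above[of ?K, OF fib] by simp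
  finally have "(2 ^ s) * (2 ^ s) \<le> card ?K * card ?K"
    using card by (simp add: mult_2 power_add)
  hence "2 ^ s \<le> card ?K" by (metis mult_strict_mono' not_le zero_le)
  with le show ?thesis by simp
qed

end

theory Submission
  imports Defs
begin

text \<open>
  Write \<open>Q\<close> for the quadratic form \<open>Tr(a x^(2^s+1)) + Tr(b x^(2^l+1))\<close> and \<open>k\<close> for half the
  dimension of the radical of its polar form. The exponential sums \<open>S\<close> of \<open>Q(x) + Tr(c x)\<close> satisfy
  \<open>S^2 = 0\<close> or \<open>S^2 = 2^(2s+2k)\<close>, and \<open>\<Sum>\<^sub>c S^2 = 2^(4s)\<close>, so the weights of the codewords
  with given \<open>a\<close>, \<open>b\<close> depend only on \<open>k\<close>. It remains to count the pairs \<open>(a, b)\<close> with each \<open>k\<close>.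

  The polar form is the trace of an alternating form over the field with \<open>2^d\<close> elements, so \<open>d\<close>
  divides \<open>k\<close>. The radical is the kernel of a polynomial of degree 2 in the automorphism
  \<open>x \<mapsto> x^(2^(s+l))\<close>, whose fixed field has \<open>2^d'\<close> elements, so \<open>k \<le> d'\<close> unless \<open>a = b = 0\<close>.
  Hence \<open>k\<close> takes the values \<open>0, d\<close> if \<open>d' = d\<close> and \<open>0, d, 2d\<close> if \<open>d' = 2d\<close>. The number of
  pairs and the sum of the sizes of the radicals give two linear equations for the
  multiplicities. If \<open>d' = 2d\<close>, then \<open>s/d\<close> and \<open>l/d\<close> are odd, so \<open>Q(x)\<close> depends only on
  \<open>x^(2^d+1)\<close>; hence \<open>S \<equiv> 1\<close> modulo \<open>2^d + 1\<close> at \<open>c = 0\<close>, which determines the sign of \<open>S\<close>, and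
  \<open>\<Sum> S = 2^(3s)\<close> over all \<open>(a, b)\<close> is the third equation.
\<close>

section \<open>Fields of characteristic two\<close>

lemma of_bit_inj_iff: "of_bit x = (of_bit y :: 'a::zero_neq_one) \<longleftrightarrow> x = y"
  by (cases x; cases y) auto

text \<open>The nontrivial additive character of \<open>bit\<close>. Integer values allow the
  exponential sums to be squared and reduced modulo \<open>2^d + 1\<close>.\<close>

definition bit_sign :: "bit \<Rightarrow> int" where
  "bit_sign x = (if x = 0 then 1 else - 1)"

lemma bit_sign_simps [simp]: "bit_sign 0 = 1" "bit_sign 1 = - 1"
  by (simp_all add: bit_sign_def)

lemma bit_sign_add: "bit_sign (x + y) = bit_sign x * bit_sign y"
  by (cases x; cases y) (auto simp: bit_sign_def)

lemma bit_sign_self_mult [simp]: "bit_sign x * bit_sign x = 1"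
  by (simp add: bit_sign_def)

text \<open>Translation by \<open>z\<close> permutes \<open>A\<close> and flips every sign, so the
  sum equals its own negative.\<close>

lemma sum_bit_sign_eq_0:
  fixes g :: "'b::ab_group_add \<Rightarrow> bit"
  assumes add: "\<And>x y. x \<in> A \<Longrightarrow> y \<in> A \<Longrightarrow> g (x + y) = g x + g y"
    and closed: "\<And>x y. x \<in> A \<Longrightarrow> y \<in> A \<Longrightarrow> x + y \<in> A"
    and inv: "\<And>x. x + x = (0::'b)"
    and z: "z \<in> A" "g z \<noteq> 0"
  shows "(\<Sum>x\<in>A. bit_sign (g x)) = 0"
proof -
  have zz: "x + z + z = x" for x using inv[of z] by (simp add: add.assoc)
  have gz: "g z = 1" using z(2) by (cases "g z") auto
  have "(\<Sum>x\<in>A. bit_sign (g x)) = (\<Sum>x\<in>A. bit_sign (g (x + z)))"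
    by (rule sum.reindex_bij_witness[of _ "\<lambda>x. x + z" "\<lambda>x. x + z"])
       (use closed z(1) zz in \<open>auto simp: add.assoc inv\<close>)
  also have "\<dots> = (\<Sum>x\<in>A. - bit_sign (g x))"
    by (rule sum.cong) (use add z(1) gz in \<open>auto simp: bit_sign_add\<close>)
  finally show ?thesis by (simp add: sum_negf)
qed

text \<open>The \<open>n\<close>-fold Frobenius as a function, so that composition becomes addition
  of exponents.\<close>

definition frob :: "nat \<Rightarrow> 'a::finite_field \<Rightarrow> 'a" where
  "frob n x = x ^ (2 ^ n)"

lemma gf_sub_frob: "x \<in> gf_sub n \<longleftrightarrow> frob n x = x"
  by (simp add: gf_sub_def frob_def)

lemma frob_mult: "frob n (x * y) = frob n x * frob n y"
  by (simp add: frob_def power_mult_distrib)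

lemma frob_divide: "frob n (x / y) = frob n x / frob n y"
  by (simp add: frob_def power_divide)

lemma frob_id [simp]: "frob n 0 = 0" "frob n 1 = 1" "frob 0 x = x"
  by (simp_all add: frob_def)

lemma frob_frob: "frob i (frob j x) = frob (i + j) x"
  by (simp add: frob_def power_add mult.commute flip: power_mult)

lemma frob_eq_0_iff [simp]: "frob n x = 0 \<longleftrightarrow> x = 0"
  by (simp add: frob_def)

lemma frob_fixed_mult: "frob i x = x \<Longrightarrow> frob (i * k) x = x"
  by (induction k) (simp_all add: frob_frob[symmetric])

section \<open>Fibres of power maps and roots of unity\<close>

lemma card_power_fibre_le:
  fixes y :: "'a::finite_field"
  assumes "n > 0"
  shows "card {x. x ^ n = y} \<le> n"
proof -
  define p where "p = monom 1 n - [:y:]"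
  have "coeff p n = 1" using assms by (cases n) (auto simp: p_def)
  hence "p \<noteq> 0" by auto
  moreover have "degree p \<le> n" unfolding p_def by (intro degree_diff_le degree_monom_le) auto
  moreover have "{x. x ^ n = y} = {x. poly p x = 0}" by (auto simp: p_def poly_monom)
  ultimately show ?thesis using card_poly_roots_bound[of p] by simp
qed

text \<open>With \<open>k = (q - 1) / n\<close>, where \<open>q\<close> is the size of the field,
  the map \<open>x \<mapsto> x^k\<close> sends nonzero elements to \<open>n\<close>-th roots of
  unity. Its fibres have at most \<open>k\<close> elements, so there are at least \<open>n\<close>
  such roots; the degree gives the upper bound.\<close>

lemma card_roots_of_unity:
  assumes "n > 0" "n dvd CARD('a::finite_field) - 1"
  shows "card {x::'a. x ^ n = 1} = n"
proof -
  obtain k where k: "CARD('a) - 1 = n * k" using assms(2) by auto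
  have "CARD('a) > 1" using card_mono[of "UNIV :: 'a set" "{0, 1}"] by simp
  hence k0: "k > 0" using k by (cases k) auto
  let ?U = "{x::'a. x ^ n = 1}"
  have "x ^ (CARD('a) - 1) = 1" if "x \<noteq> 0" for x :: 'a
  proof -
    have "x * x ^ (CARD('a) - 1) = x" using finite_field_power_card_eq_same[of x] \<open>CARD('a) > 1\<close>
      by (metis One_nat_def Suc_pred less_trans power_Suc zero_less_one)
    thus ?thesis using that by simp
  qed
  hence "- {0} \<subseteq> (\<Union>y\<in>?U. {x::'a. x ^ k = y})"
    unfolding k by (fastforce simp: mult.commute simp flip: power_mult)
  hence "card (- {0::'a}) \<le> card (\<Union>y\<in>?U. {x::'a. x ^ k = y})" by (intro card_mono) auto
  also have "\<dots> \<le> (\<Sum>y\<in>?U. card {x::'a. x ^ k = y})" by (rule card_UN_le) simp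
  also have "\<dots> \<le> card ?U * k" using sum_bounded_above[of ?U, OF card_power_fibre_le[OF k0]] by simp
  finally have "n * k \<le> card ?U * k" using k by (simp add: Compl_eq_Diff_UNIV card_Diff_singleton)
  hence "n \<le> card ?U" using k0 by simp
  with card_power_fibre_le[OF assms(1), of "1::'a"] show ?thesis by simp
qed

locale binary_field =
  fixes m :: nat and type_of_field :: "'a::finite_field itself"
  assumes card_field: "CARD('a) = 2 ^ m"
begin

lemma char_2: "CHAR('a) = 2"
  using CHAR_eq_2[OF card_field] .

lemma m_pos: "m > 0"
proof (rule ccontr)
  assume "\<not> m > 0"
  hence "card (UNIV :: 'a set) = 1" using card_field by simp
  then obtain z where "(UNIV :: 'a set) = {z}" by (rule card_1_singletonE)
  hence "(0 :: 'a) = 1" by (metis UNIV_I singletonD)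
  thus False by simp
qed

lemma add_self: "x + x = (0::'a)"
  using add_self_2[OF char_2] .

lemma two_eq_0 [simp]: "(2::'a) = 0"
  using add_self[of 1] by simp

lemma add_self_left: "x + (x + y) = (y::'a)"
  by (simp add: add_self flip: add.assoc)

lemma add_eq_0_iff: "x + y = 0 \<longleftrightarrow> x = (y::'a)"
  by (metis add_self add_left_cancel add.commute)

lemma frob_add: "frob n (x + y) = frob n x + frob n (y::'a)"
  using power_add_2[OF char_2] by (simp add: frob_def)

lemma frob_sum: "frob n (sum f A) = (\<Sum>i\<in>A. frob n (f i :: 'a))"
  by (induction A rule: infinite_finite_induct) (simp_all add: frob_add)

lemma frob_m [simp]: "frob m x = (x::'a)"
  using finite_field_power_card_eq_same[of x] by (simp add: frob_def card_field)

text \<open>Euclid's algorithm on the exponents: on elements fixed by \<open>frob j\<close>,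
  \<open>frob i\<close> acts as \<open>frob (i mod j)\<close>.\<close>

lemma frob_gcd:
  assumes "frob i x = (x::'a)" "frob j x = x"
  shows "frob (gcd i j) x = x"
  using assms
proof (induction i j rule: gcd_nat_induct)
  case (step i j)
  have "frob i x = frob (i mod j) (frob (j * (i div j)) x)" by (simp add: frob_frob)
  also have "\<dots> = frob (i mod j) x" using frob_fixed_mult[OF step.prems(2)] by simp
  finally have "frob (gcd j (i mod j)) x = x" using step by simp
  thus ?case by (metis gcd_red_nat)
qed simp

lemma gf_sub_gcd: "gf_sub i \<inter> gf_sub j = (gf_sub (gcd i j) :: 'a set)"
proof -
  have "frob (gcd i j * k) x = x" if "frob (gcd i j) x = x" for k and x :: 'a
    using frob_fixed_mult[OF that] .
  hence "frob i x = x \<and> frob j x = x" if "frob (gcd i j) x = x" for x :: 'a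
    using that by (metis dvd_div_mult_self gcd_dvd1 gcd_dvd2 mult.commute)
  thus ?thesis using frob_gcd by (auto simp: gf_sub_frob)
qed

lemma card_gf_sub_le:
  assumes "n > 0"
  shows "card (gf_sub n :: 'a set) \<le> 2 ^ n"
proof -
  have n1: "(2::nat) ^ n > 1" using assms by (intro one_less_power) auto
  define p :: "'a poly" where "p = monom 1 (2 ^ n) - monom 1 1"
  have "coeff p (2 ^ n) = 1" using n1 by (simp add: p_def)
  hence p0: "p \<noteq> 0" by auto
  have deg: "degree p \<le> 2 ^ n" unfolding p_def using n1
    by (intro degree_diff_le degree_monom_le le_trans[OF degree_monom_le]) auto
  have "gf_sub n = {x. poly p x = 0}" by (auto simp: p_def gf_sub_def poly_monom)
  thus ?thesis using card_poly_roots_bound[OF p0] deg by simp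
qed

section \<open>The trace onto the subfield with \<open>2^d\<close> elements, for
  \<open>d dvd m\<close>\<close>

definition rel_trace :: "nat \<Rightarrow> 'a \<Rightarrow> 'a" where
  "rel_trace d x = (\<Sum>i<m div d. frob (d * i) x)"

lemma rel_trace_0 [simp]: "rel_trace d 0 = 0"
  by (simp add: rel_trace_def)

lemma rel_trace_add: "rel_trace d (x + y) = rel_trace d x + rel_trace d y"
  by (simp add: rel_trace_def frob_add sum.distrib)

lemma rel_trace_scale: "t \<in> gf_sub d \<Longrightarrow> rel_trace d (t * x) = t * rel_trace d x"
  by (simp add: rel_trace_def frob_mult gf_sub_frob frob_fixed_mult sum_distrib_left)

text \<open>\<open>frob d\<close> shifts the summands cyclically: the last one becomes
  \<open>frob m x\<close>, which is the first.\<close>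

lemma rel_trace_frob_1:
  assumes "d dvd m"
  shows "rel_trace d (frob d x) = rel_trace d x"
proof -
  define f where "f = (\<lambda>i. frob (d * i) x)"
  have "rel_trace d (frob d x) = (\<Sum>i<m div d. f (Suc i))"
    by (simp add: rel_trace_def f_def frob_frob add.commute)
  moreover have "f (m div d) = f 0" using assms by (simp add: f_def)
  ultimately show ?thesis
    using sum.lessThan_Suc_shift[of f "m div d"] sum.lessThan_Suc[of f "m div d"]
    by (simp add: rel_trace_def f_def add.commute)
qed

lemma rel_trace_frob:
  assumes "d dvd m" "d dvd k"
  shows "rel_trace d (frob k x) = rel_trace d x"
proof -
  obtain j where "k = d * j" using assms(2) by auto
  moreover have "rel_trace d (frob (d * j) x) = rel_trace d x" for j
    by (induction j) (simp_all add: frob_frob[symmetric] rel_trace_frob_1[OF assms(1)])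
  ultimately show ?thesis by simp
qed

lemma rel_trace_in_gf_sub:
  assumes "d dvd m"
  shows "rel_trace d x \<in> gf_sub d"
proof -
  have "frob d (rel_trace d x) = rel_trace d (frob d x)"
    by (simp add: rel_trace_def frob_sum frob_frob add.commute)
  thus ?thesis using rel_trace_frob_1[OF assms] by (simp add: gf_sub_frob)
qed

text \<open>The trace is a polynomial function of degree \<open>2^(m - d)\<close>.\<close>

lemma card_rel_trace_fibre_le:
  assumes "d dvd m"
  shows "card {x. rel_trace d x = y} \<le> 2 ^ (m - d)"
proof -
  have d: "d > 0" and n: "m div d > 0" using assms m_pos by (auto simp: dvd_div_eq_0_iff)
  have md: "d * (m div d) = m" using assms by simp
  define N where "N = m div d - 1"
  have N: "m div d = Suc N" using n by (simp add: N_def)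
  have dN: "d * N = m - d" using md N by (metis add_diff_cancel_left' mult_Suc_right)
  define p :: "'a poly" where "p = (\<Sum>i<m div d. monom 1 (2 ^ (d * i))) - [:y:]"
  have "coeff p (2 ^ (m - d)) = (\<Sum>i<m div d. if i = N then 1 else 0)"
  proof -
    have "coeff [:y:] (2 ^ (m - d)) = 0" by (cases "2 ^ (m - d) :: nat") auto
    thus ?thesis unfolding p_def coeff_diff coeff_sum using d
      by (auto intro!: sum.cong simp: dN[symmetric])
  qed
  hence "coeff p (2 ^ (m - d)) = 1" using N by simp
  hence p0: "p \<noteq> 0" by auto
  have "degree p \<le> 2 ^ (m - d)" unfolding p_def
  proof (intro degree_diff_le degree_sum_le)
    fix i assume "i \<in> {..<m div d}"
    hence "d * i \<le> m - d" using N by (subst dN[symmetric], intro mult_left_mono) auto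
    thus "degree (monom (1::'a) (2 ^ (d * i))) \<le> 2 ^ (m - d)"
      by (simp add: degree_monom_eq)
  qed auto
  moreover have "{x. rel_trace d x = y} = {x. poly p x = 0}"
    by (auto simp: p_def poly_sum poly_monom rel_trace_def frob_def)
  ultimately show ?thesis using card_poly_roots_bound[OF p0] by simp
qed

lemma rel_trace_fibres:
  assumes "d dvd m"
  shows "(\<Sum>y\<in>gf_sub d. card {x. rel_trace d x = y}) = 2 ^ m"
proof -
  have "2 ^ m = card (\<Union>y\<in>gf_sub d. {x. rel_trace d x = y})"
    using rel_trace_in_gf_sub[OF assms] by (subst card_field[symmetric], intro arg_cong[where f = card]) auto
  also have "\<dots> = (\<Sum>y\<in>gf_sub d. card {x. rel_trace d x = y})"
    by (rule card_UN_disjoint) auto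
  finally show ?thesis by simp
qed

lemma power_m_split: "d dvd m \<Longrightarrow> 2 ^ d * 2 ^ (m - d) = (2 ^ m :: nat)"
  using m_pos by (simp add: dvd_imp_le flip: power_add)

text \<open>The trace fibres over \<open>gf_sub d\<close> cover the field and have at most
  \<open>2^(m - d)\<close> elements each, so there are at least \<open>2^d\<close> of them. The
  degree of \<open>X^(2^d) - X\<close> gives the other bound.\<close>

lemma card_gf_sub_dvd:
  assumes "d dvd m"
  shows "card (gf_sub d :: 'a set) = 2 ^ d"
proof -
  have "(2::nat) ^ d * 2 ^ (m - d) \<le> card (gf_sub d :: 'a set) * 2 ^ (m - d)"
    using sum_bounded_above[of "gf_sub d" "\<lambda>y. card {x. rel_trace d x = y}" "2 ^ (m - d)"]
      card_rel_trace_fibre_le[OF assms]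
    by (simp add: rel_trace_fibres[OF assms] power_m_split[OF assms])
  hence "2 ^ d \<le> card (gf_sub d :: 'a set)" by simp
  moreover have "d > 0" using assms m_pos by (auto intro: Nat.gr0I)
  ultimately show ?thesis using card_gf_sub_le[of d] by simp
qed

text \<open>The upper bounds for the fibres add up to exactly the size of the field, so each bound
  is attained.\<close>

lemma card_rel_trace_fibre:
  assumes "d dvd m" "y \<in> gf_sub d"
  shows "card {x. rel_trace d x = y} = 2 ^ (m - d)"
proof (rule sum_mono_inv[of _ "gf_sub d" "\<lambda>_. 2 ^ (m - d)"])
  show "(\<Sum>y\<in>gf_sub d. card {x. rel_trace d x = y}) = (\<Sum>y\<in>(gf_sub d::'a set). 2 ^ (m - d))"
    by (simp add: rel_trace_fibres assms card_gf_sub_dvd power_m_split)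
qed (use assms card_rel_trace_fibre_le in auto)

text \<open>Some \<open>x\<close> has trace \<open>1\<close>; for \<open>z \<noteq> 0\<close> the
  choice \<open>y = x / z\<close> gives a contradiction.\<close>

lemma rel_trace_nondegenerate:
  assumes "d dvd m" "\<And>y. rel_trace d (z * y) = 0"
  shows "z = 0"
proof (rule ccontr)
  assume "z \<noteq> 0"
  have "card {x. rel_trace d x = 1} \<noteq> 0"
    using card_rel_trace_fibre[OF assms(1), of 1] by (simp add: gf_sub_frob)
  then obtain x where "rel_trace d x = 1" by (metis (mono_tags, lifting) Collect_empty_eq card.empty)
  with assms(2)[of "x / z"] \<open>z \<noteq> 0\<close> show False by simp
qed

section \<open>Radicals\<close>

text \<open>Reduction of order: substituting \<open>x = x\<^sub>0 z\<close> for a nonzero root \<open>x\<^sub>0\<close> leaves a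
  first-order equation for \<open>frob n z + z\<close>.\<close>
lemma card_frob_quadratic_kernel_le:
  fixes a b e :: 'a
  assumes "b \<noteq> 0" "e \<noteq> 0"
  shows "card {x. b * frob (2 * n) x + a * frob n x + e * x = 0} \<le> (card (gf_sub n :: 'a set))\<^sup>2"
    (is "card ?V \<le> ?N\<^sup>2")
proof (cases "?V \<subseteq> {0}")
  case True
  have "card {0 :: 'a} \<le> ?N" by (rule card_mono) (auto simp: gf_sub_frob)
  hence "1 \<le> ?N\<^sup>2" by (simp add: power2_eq_square)
  moreover have "card ?V \<le> card {0 :: 'a}" using True by (intro card_mono) auto
  ultimately show ?thesis by simp
next
  case False
  then obtain x0 where x0: "x0 \<noteq> 0" "x0 \<in> ?V" by auto
  define A where "A = b * frob (2 * n) x0"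
  define C where "C = e * x0"
  have nz: "A \<noteq> 0" "C \<noteq> 0" using assms x0 by (auto simp: A_def C_def)
  let ?W = "{w. A * frob n w = C * w}"
  \<comment> \<open>The quotient of two nonzero solutions is fixed by \<open>frob n\<close>, so
    \<open>?W\<close> is at most a line over the fixed field.\<close>
  have W: "card ?W \<le> ?N"
  proof (cases "?W \<subseteq> {0}")
    case True
    hence "?W = {0}" by auto
    moreover have "card {0 :: 'a} \<le> ?N" by (rule card_mono) (auto simp: gf_sub_frob)
    ultimately show ?thesis by simp
  next
    case False
    then obtain w0 where w0: "w0 \<noteq> 0" "w0 \<in> ?W" by auto
    have "(\<lambda>w. w / w0) ` ?W \<subseteq> gf_sub n"
    proof clarify
      fix w assume w: "A * frob n w = C * w"
      have "frob n w = C * w / A" "frob n w0 = C * w0 / A"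
        using w w0 nz by (auto simp: field_simps)
      thus "w / w0 \<in> gf_sub n" using nz by (simp add: gf_sub_frob frob_divide)
    qed
    moreover have "inj_on (\<lambda>w. w / w0) ?W" using w0 by (auto intro: inj_onI)
    ultimately show ?thesis by (intro card_inj_on_le) auto
  qed
  define g where "g = (\<lambda>x. frob n (x / x0) + x / x0)"
  have sub: "?V \<subseteq> (\<Union>w\<in>?W. {x. g x = w})"
  proof clarify
    fix x assume x: "b * frob (2 * n) x + a * frob n x + e * x = 0"
    define z where "z = x / x0"
    have xz: "x = x0 * z" using x0 by (simp add: z_def)
    \<comment> \<open>That \<open>x0\<close> is a root expresses the middle coefficient by
      \<open>A\<close> and \<open>C\<close>; the equation for \<open>z\<close> then depends only on
      \<open>frob n z + z\<close>.\<close>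
    have "A + a * frob n x0 + C = 0" using x0 by (simp add: A_def C_def)
    hence "a * frob n x0 + (A + C) = 0" by (simp only: ac_simps)
    hence a: "a * frob n x0 = A + C" by (simp only: add_eq_0_iff)
    have "A * frob (2 * n) z + (a * frob n x0) * frob n z + C * z = 0"
      using x by (simp add: xz frob_mult A_def C_def algebra_simps)
    hence "(A * frob (2 * n) z + A * frob n z) + (C * frob n z + C * z) = 0"
      unfolding a by (simp only: algebra_simps)
    hence "A * frob (2 * n) z + A * frob n z = C * frob n z + C * z"
      by (simp only: add_eq_0_iff)
    hence "A * frob n (g x) = C * g x"
      by (simp add: g_def frob_add frob_frob mult_2 distrib_left flip: z_def)
    thus "x \<in> (\<Union>w\<in>?W. {x. g x = w})" by blast
  qed
  \<comment> \<open>\<open>g\<close> is additive, and \<open>g x = 0\<close> exactly when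
    \<open>x / x0\<close> is fixed by \<open>frob n\<close>; a fibre is a coset of this
    kernel.\<close>
  have fib: "card {x. g x = w} \<le> ?N" for w
  proof (cases "\<exists>x1. g x1 = w")
    case True
    then obtain x1 where x1: "g x1 = w" by blast
    have "(\<lambda>x. (x + x1) / x0) ` {x. g x = w} \<subseteq> gf_sub n"
    proof (rule image_subsetI)
      fix x assume "x \<in> {x. g x = w}"
      hence "g x + g x1 = 0" by (simp only: x1 add_eq_0_iff mem_Collect_eq)
      moreover have "g x + g x1 = frob n ((x + x1) / x0) + (x + x1) / x0"
        unfolding g_def add_divide_distrib frob_add by (simp only: add.assoc add.left_commute)
      ultimately have "frob n ((x + x1) / x0) + (x + x1) / x0 = 0" by metis
      thus "(x + x1) / x0 \<in> gf_sub n" by (simp only: gf_sub_frob add_eq_0_iff)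
    qed
    moreover have "inj_on (\<lambda>x. (x + x1) / x0) {x. g x = w}" by (rule inj_onI) (use x0 in simp)
    ultimately show ?thesis by (intro card_inj_on_le) auto
  qed simp
  have "card ?V \<le> card (\<Union>w\<in>?W. {x. g x = w})" by (rule card_mono[OF _ sub]) simp
  also have "\<dots> \<le> (\<Sum>w\<in>?W. card {x. g x = w})" by (rule card_UN_le) simp
  also have "\<dots> \<le> card ?W * ?N" using sum_bounded_above[of ?W "\<lambda>w. card {x. g x = w}" ?N] fib by simp
  also have "\<dots> \<le> ?N\<^sup>2" using W by (simp add: power2_eq_square)
  finally show ?thesis .
qed

text \<open>Induction by splitting off a hyperbolic plane.\<close>
lemma card_alternating_radical:
  fixes B :: "'a \<Rightarrow> 'a \<Rightarrow> 'a"
  assumes d: "d dvd m"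
    and add: "\<And>x y z. B (x + y) z = B x z + B y z"
    and scale: "\<And>t x z. t \<in> gf_sub d \<Longrightarrow> B (t * x) z = t * B x z"
    and sym: "\<And>x y. B x y = B y x"
    and alt: "\<And>x. B x x = 0"
    and val: "\<And>x y. B x y \<in> gf_sub d"
  assumes "0 \<in> V" "\<And>x y. x \<in> V \<Longrightarrow> y \<in> V \<Longrightarrow> x + y \<in> V"
    "\<And>t x. t \<in> gf_sub d \<Longrightarrow> x \<in> V \<Longrightarrow> t * x \<in> V"
  shows "\<exists>j. card V = (2 ^ d) ^ (2 * j) * card {x \<in> V. \<forall>y\<in>V. B x y = 0}"
  using assms(7-)
proof (induction "card V" arbitrary: V rule: less_induct)
  case less
  note V = less.prems
  let ?rad = "\<lambda>V. {x \<in> V. \<forall>y\<in>V. B x y = 0}"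
  let ?K = "gf_sub d :: 'a set"
  have addr: "B z (x + y) = B z x + B z y" for x y z using add sym by metis
  have scaler: "B z (t * x) = t * B z x" if "t \<in> ?K" for t x z using scale[OF that] sym by metis
  show ?case
  proof (cases "\<exists>x\<in>V. \<exists>y\<in>V. B x y \<noteq> 0")
    case False
    hence "?rad V = V" by auto
    thus ?thesis by (intro exI[of _ 0]) simp
  next
    case True
    then obtain x y0 where xy0: "x \<in> V" "y0 \<in> V" "B x y0 \<noteq> 0" by blast
    \<comment> \<open>Normalised so that \<open>B x y = 1\<close>, which makes \<open>x\<close>,
      \<open>y\<close> a hyperbolic pair.\<close>
    define y where "y = inverse (B x y0) * y0"
    have iK: "inverse (B x y0) \<in> ?K" using gf_sub_closed(5)[OF char_2 val] .
    have y: "y \<in> V" "B x y = 1" "B y x = 1"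
      using xy0 V(3)[OF iK, of y0] sym[of y0 x] by (simp_all add: y_def scaler[OF iK] scale[OF iK])
    \<comment> \<open>The orthogonal complement of the plane spanned by \<open>x\<close> and
      \<open>y\<close>.\<close>
    define W where "W = {z \<in> V. B x z = 0 \<and> B y z = 0}"
    have B0: "B z 0 = 0" for z using addr[of z 0 0] by (simp only: add_self add_0_left)
    have W: "0 \<in> W" "\<And>x y. x \<in> W \<Longrightarrow> y \<in> W \<Longrightarrow> x + y \<in> W"
      "\<And>t x. t \<in> ?K \<Longrightarrow> x \<in> W \<Longrightarrow> t * x \<in> W"
      unfolding W_def using V(1) V(2) V(3) by (simp_all add: B0 addr scaler)
    let ?f = "\<lambda>(\<alpha>, \<beta>, w). \<alpha> * x + \<beta> * y + w"
    have bij: "bij_betw ?f (?K \<times> ?K \<times> W) V"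
    \<comment> \<open>Since \<open>B x x = B y y = 0\<close> and \<open>B x y = 1\<close>, the
      coefficient of \<open>x\<close> in \<open>z\<close> is read off by \<open>B y\<close> and that
      of \<open>y\<close> by \<open>B x\<close>. Subtracting the plane component is addition in
      characteristic two.\<close>
    proof (rule bij_betw_byWitness[where f' = "\<lambda>z. (B y z, B x z, z + B y z * x + B x z * y)"])
      show "\<forall>p\<in>?K \<times> ?K \<times> W. (\<lambda>z. (B y z, B x z, z + B y z * x + B x z * y)) (?f p) = p"
      proof
        fix p assume "p \<in> ?K \<times> ?K \<times> W"
        then obtain \<alpha> \<beta> w where p: "p = (\<alpha>, \<beta>, w)" and h: "\<alpha> \<in> ?K" "\<beta> \<in> ?K" "w \<in> W" by auto
        define z where "z = \<alpha> * x + \<beta> * y + w"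
        have "B y z = \<alpha>" "B x z = \<beta>" using h y alt by (auto simp: z_def addr scaler W_def)
        moreover have "u + v + w + u + v = (u + v) + ((u + v) + w)" for u v
          by (simp only: ac_simps)
        hence "z + \<alpha> * x + \<beta> * y = w" unfolding z_def by (simp only: add_self_left)
        ultimately show "(\<lambda>z. (B y z, B x z, z + B y z * x + B x z * y)) (?f p) = p"
          by (simp add: p flip: z_def)
      qed
      show "\<forall>z\<in>V. ?f (B y z, B x z, z + B y z * x + B x z * y) = z"
      proof clarify
        fix z
        have "u + v + (z + u + v) = (u + v) + ((u + v) + z)" for u v :: 'a
          by (simp only: ac_simps)
        thus "B y z * x + B x z * y + (z + B y z * x + B x z * y) = z"
          by (simp only: add_self_left)
      qed
      show "?f ` (?K \<times> ?K \<times> W) \<subseteq> V" 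
        using xy0(1) y(1) by (auto simp: W_def intro!: V(2) V(3))
      show "(\<lambda>z. (B y z, B x z, z + B y z * x + B x z * y)) ` V \<subseteq> ?K \<times> ?K \<times> W"
        using xy0(1) y by (auto simp: W_def addr scaler val alt intro!: V(2) V(3))
    qed
    have cV: "card V = (2 ^ d) ^ 2 * card W"
      using bij_betw_same_card[OF bij] by (simp add: card_cartesian_product card_gf_sub_dvd[OF d] power2_eq_square)
    have "d > 0" using d m_pos by (auto intro: Nat.gr0I)
    hence "((2::nat) ^ d) ^ 2 > 1" using one_less_power[of "2::nat" "d * 2"] by (simp add: power_mult)
    moreover have "card W > 0" using W(1) by (auto simp: card_gt_0_iff)
    ultimately have "card W < card V" by (simp add: cV)
    hence "\<exists>j. card W = (2 ^ d) ^ (2 * j) * card (?rad W)"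
      by (rule less.hyps) (fact W)+
    then obtain j where j: "card W = (2 ^ d) ^ (2 * j) * card (?rad W)" ..
    \<comment> \<open>\<open>V\<close> is the orthogonal sum of \<open>W\<close> and the
      nondegenerate plane, so the plane contributes nothing to the radical.\<close>
    have "?rad W = ?rad V"
    proof (intro equalityI subsetI)
      fix z assume z: "z \<in> ?rad W"
      have "B z v = 0" if "v \<in> V" for v
      proof -
        have "v \<in> ?f ` (?K \<times> ?K \<times> W)" using that bij by (simp add: bij_betw_def)
        then obtain p where p: "v = ?f p" "p \<in> ?K \<times> ?K \<times> W" by (rule imageE)
        obtain \<alpha> \<beta> w where "p = (\<alpha>, \<beta>, w)" by (rule prod_cases3)
        hence v: "\<alpha> \<in> ?K" "\<beta> \<in> ?K" "w \<in> W" "v = \<alpha> * x + \<beta> * y + w"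
          using p by simp_all
        moreover have "B z w = 0" "B z x = 0" "B z y = 0"
          using z v(3) sym[of z x] sym[of z y] by (simp_all add: W_def)
        ultimately show ?thesis by (simp add: addr scaler)
      qed
      thus "z \<in> ?rad V" using z by (auto simp: W_def)
    next
      fix z assume "z \<in> ?rad V"
      thus "z \<in> ?rad W" using xy0(1) y(1) sym[of x z] sym[of y z] by (simp add: W_def)
    qed
    hence "card V = (2 ^ d) ^ (2 * Suc j) * card (?rad V)"
      using cV j by (simp add: power_add power2_eq_square mult_ac)
    thus ?thesis by blast
  qed
qed

section \<open>Absolute trace, orthogonality of characters, and sums of quadratic functions\<close>

lemma gf_sub_m: "gf_sub m = (UNIV :: 'a set)"
  using gf_sub_UNIV[OF card_field] .

lemma of_bit_abs_trace_m: "of_bit (abs_trace m x) = rel_trace 1 x"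
  using of_bit_abs_trace[OF char_2, of x m] by (simp add: gf_sub_m rel_trace_def frob_def)

lemma of_bit_add: "of_bit (u + v) = (of_bit u + of_bit v :: 'a)"
  by (cases u; cases v) auto

lemma bit_eqI: "of_bit u = (of_bit v :: 'a) \<Longrightarrow> u = v"
  by (simp only: of_bit_inj_iff)

lemma abs_trace_m_add: "abs_trace m (x + y) = abs_trace m x + abs_trace m (y :: 'a)"
  by (rule bit_eqI) (simp only: of_bit_add of_bit_abs_trace_m rel_trace_add)

lemma abs_trace_m_0 [simp]: "abs_trace m (0 :: 'a) = 0"
  using abs_trace_m_add[of 0 0] by (cases "abs_trace m (0 :: 'a)") auto

lemma abs_trace_m_frob: "abs_trace m (frob k x) = abs_trace m (x :: 'a)"
  by (rule bit_eqI) (simp only: of_bit_abs_trace_m rel_trace_frob one_dvd)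

lemma abs_trace_m_nondegenerate:
  assumes "z \<noteq> (0 :: 'a)"
  obtains y where "abs_trace m (y * z) \<noteq> 0"
proof -
  have "\<not> (\<forall>y. rel_trace 1 (z * y) = 0)"
    using rel_trace_nondegenerate[of 1 z] assms by auto
  then obtain y where "of_bit (abs_trace m (y * z)) \<noteq> (0 :: 'a)"
    by (auto simp only: of_bit_abs_trace_m mult.commute)
  thus ?thesis by (intro that[of y]) auto
qed

text \<open>Orthogonality of additive characters: for \<open>x \<noteq> 0\<close> the additive map
  \<open>c \<mapsto> abs_trace m (c * x)\<close> is nonzero by nondegeneracy of the trace.\<close>

lemma sum_bit_sign_abs_trace_m:
  "(\<Sum>c\<in>UNIV. bit_sign (abs_trace m (c * x))) = (if x = (0::'a) then 2 ^ m else 0)"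
proof (cases "x = 0")
  case True
  thus ?thesis by (simp add: card_field)
next
  case False
  then obtain y where "abs_trace m (y * x) \<noteq> 0" by (rule abs_trace_m_nondegenerate)
  hence "(\<Sum>c\<in>UNIV. bit_sign (abs_trace m (c * x))) = 0"
    by (intro sum_bit_sign_eq_0) (simp_all add: distrib_right abs_trace_m_add add_self)
  thus ?thesis using False by simp
qed

context
  fixes g :: "'a \<Rightarrow> bit" and L :: "'a \<Rightarrow> 'a"
  assumes quadratic: "\<And>x y. g (x + y) = g x + g y + abs_trace m (L x * y)"
begin

text \<open>In the double sum put \<open>z = y + x\<close>. The two copies of \<open>g x\<close>
  cancel and \<open>x\<close> occurs only linearly, in \<open>abs_trace m (L y * x)\<close>, so the
  sum over \<open>x\<close> vanishes unless \<open>L y = 0\<close>.\<close>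

lemma quadratic_sum_square_eq:
  "(\<Sum>x\<in>UNIV. bit_sign (g x))\<^sup>2 = 2 ^ m * (\<Sum>y | L y = 0. bit_sign (g y))"
proof -
  have "(\<Sum>x\<in>UNIV. bit_sign (g x))\<^sup>2 = (\<Sum>x\<in>UNIV. \<Sum>z\<in>UNIV. bit_sign (g x) * bit_sign (g z))"
    by (simp add: power2_eq_square sum_product)
  also have "\<dots> = (\<Sum>x\<in>UNIV. \<Sum>y\<in>UNIV. bit_sign (g x) * bit_sign (g (y + x)))"
  proof (rule sum.cong[OF refl])
    fix x
    show "(\<Sum>z\<in>UNIV. bit_sign (g x) * bit_sign (g z)) = (\<Sum>y\<in>UNIV. bit_sign (g x) * bit_sign (g (y + x)))"
      by (rule sum.reindex_bij_witness[of _ "\<lambda>y. y + x" "\<lambda>y. y + x"]) (simp_all add: add.assoc)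
  qed
  also have "\<dots> = (\<Sum>x\<in>UNIV. \<Sum>y\<in>UNIV. bit_sign (g y) * bit_sign (abs_trace m (x * L y)))"
  proof (intro sum.cong refl)
    fix x y
    have "bit_sign (g x) * bit_sign (g (y + x)) =
      (bit_sign (g x) * bit_sign (g x)) * (bit_sign (g y) * bit_sign (abs_trace m (L y * x)))"
      unfolding quadratic bit_sign_add by (simp only: ac_simps)
    thus "bit_sign (g x) * bit_sign (g (y + x)) = bit_sign (g y) * bit_sign (abs_trace m (x * L y))"
      by (simp add: mult.commute)
  qed
  also have "\<dots> = (\<Sum>y\<in>UNIV. bit_sign (g y) * (\<Sum>x\<in>UNIV. bit_sign (abs_trace m (x * L y))))"
    by (subst sum.swap) (simp add: sum_distrib_left)
  also have "\<dots> = (\<Sum>y\<in>UNIV. if L y = 0 then 2 ^ m * bit_sign (g y) else 0)"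
    by (rule sum.cong) (simp_all add: sum_bit_sign_abs_trace_m)
  also have "\<dots> = 2 ^ m * (\<Sum>y | L y = 0. bit_sign (g y))"
    by (simp add: sum.If_cases sum_distrib_left)
  finally show ?thesis .
qed

text \<open>\<open>g\<close> is additive on the kernel of \<open>L\<close>, so its character sum
  there is \<open>0\<close> or the size of the kernel.\<close>

lemma quadratic_sum_square:
  assumes "L 0 = 0" and L_add: "\<And>x y. L (x + y) = L x + L y"
  shows "(\<Sum>x\<in>UNIV. bit_sign (g x))\<^sup>2 \<in> {0, 2 ^ m * int (card {y. L y = 0})}"
proof (cases "\<exists>z. L z = 0 \<and> g z \<noteq> 0")
  case True
  then obtain z where "L z = 0" "g z \<noteq> 0" by blast
  hence "(\<Sum>y | L y = 0. bit_sign (g y)) = 0"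
    by (intro sum_bit_sign_eq_0[where z = z])
       (simp_all only: quadratic L_add add_self mem_Collect_eq mult_zero_left abs_trace_m_0 add_0_right not_False_eq_True)
  thus ?thesis by (simp add: quadratic_sum_square_eq)
next
  case False
  hence "(\<Sum>y | L y = 0. bit_sign (g y)) = (\<Sum>y | L y = 0. 1)" by (intro sum.cong) auto
  thus ?thesis by (simp add: quadratic_sum_square_eq)
qed

end

end

section \<open>The field as a quadratic extension of \<open>gf_sub s\<close>\<close>

locale half_field = binary_field "2 * s" type_of_field
  for s :: nat and type_of_field :: "'a::finite_field itself"
begin

abbreviation trace :: "'a \<Rightarrow> bit" where "trace \<equiv> abs_trace (2 * s)"

lemma s_pos: "s > 0"
  using m_pos by simp

lemma rel_trace_half: "rel_trace s x = x + frob s x"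
proof -
  have "2 * s div s = 2" using s_pos by simp
  thus ?thesis unfolding rel_trace_def by (simp add: numeral_2_eq_2)
qed

lemma half_fibre: "y \<in> gf_sub s \<Longrightarrow> card {x. x + frob s x = (y :: 'a)} = 2 ^ s"
  using card_rel_trace_fibre[of s y] by (simp add: rel_trace_half)

lemma half_in: "(x :: 'a) + frob s x \<in> gf_sub s"
  using rel_trace_in_gf_sub[of s x] by (simp add: rel_trace_half)

lemma half_surj:
  assumes "(y :: 'a) \<in> gf_sub s"
  obtains z where "y = z + frob s z"
proof -
  have "{x. x + frob s x = y} \<noteq> {}" using half_fibre[OF assms] by (intro notI) simp
  thus ?thesis using that by auto
qed

lemma frob_s_s: "frob s (frob s x) = (x :: 'a)"
  using frob_m[of x] by (simp add: frob_frob mult_2)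

lemma norm_in: "(x :: 'a) * frob s x \<in> gf_sub s"
  by (simp add: gf_sub_frob frob_mult frob_s_s mult.commute)

lemma card_half: "card (gf_sub s :: 'a set) = 2 ^ s"
  by (rule card_gf_sub_dvd) simp

text \<open>Transitivity of the trace: the \<open>2 * s\<close> conjugates of \<open>z\<close> split
  into the first \<open>s\<close> and their images under \<open>frob s\<close>.\<close>

lemma abs_trace_half: "abs_trace s (z + frob s z) = trace z"
proof (rule bit_eqI)
  have "of_bit (abs_trace s (z + frob s z)) = (\<Sum>i<s. frob i z) + (\<Sum>i<s. frob (i + s) z)"
    using of_bit_abs_trace[OF char_2 half_in[of z]]
    by (simp add: frob_def[symmetric] frob_add frob_frob sum.distrib)
  also have "(\<Sum>i<s. frob (i + s) z) = (\<Sum>i=s..<2 * s. frob i z)"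
    using sum.shift_bounds_nat_ivl[of "\<lambda>i. frob i z" 0 s s] by (simp add: lessThan_atLeast0 mult_2)
  also have "(\<Sum>i<s. frob i z) + (\<Sum>i=s..<2 * s. frob i z) = (\<Sum>i<2 * s. frob i z)"
    by (simp add: lessThan_atLeast0 sum.atLeastLessThan_concat)
  also have "\<dots> = rel_trace 1 z" by (simp add: rel_trace_def)
  also have "\<dots> = of_bit (trace z)" by (rule of_bit_abs_trace_m[symmetric])
  finally show "of_bit (abs_trace s (z + frob s z)) = (of_bit (trace z) :: 'a)" .
qed

text \<open>Every element of \<open>gf_sub s\<close> has the form \<open>z + frob s z\<close>, which
  reduces additivity to that of \<open>trace\<close>.\<close>

lemma abs_trace_s_add:
  assumes "x \<in> gf_sub s" "y \<in> gf_sub s"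
  shows "abs_trace s (x + y) = abs_trace s x + abs_trace s (y :: 'a)"
proof -
  obtain u v where uv: "x = u + frob s u" "y = v + frob s v"
    using half_surj assms by metis
  have "x + y = (u + v) + frob s (u + v)" unfolding uv frob_add by (simp only: ac_simps)
  hence "abs_trace s (x + y) = trace (u + v)" by (simp only: abs_trace_half)
  thus ?thesis unfolding uv by (simp only: abs_trace_half abs_trace_m_add)
qed

lemma abs_trace_s_0 [simp]: "abs_trace s (0 :: 'a) = 0"
  using abs_trace_half[of 0] by simp

lemma sum_bit_sign_abs_trace_s:
  assumes y: "y \<in> gf_sub s"
  shows "(\<Sum>a\<in>gf_sub s. bit_sign (abs_trace s (a * y))) = (if y = (0::'a) then 2 ^ s else 0)"
proof (cases "y = 0")
  case True
  thus ?thesis by (simp add: card_half)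
next
  case False
  then obtain z where z: "trace (z * y) \<noteq> 0" by (rule abs_trace_m_nondegenerate[of y])
  \<comment> \<open>\<open>y\<close> is fixed by \<open>frob s\<close>, so a \<open>z\<close> with
    \<open>trace (z * y) \<noteq> 0\<close> yields the element \<open>z + frob s z\<close> of
    \<open>gf_sub s\<close> on which the character is nontrivial.\<close>
  have "(z + frob s z) * y = z * y + frob s (z * y)"
    using y by (simp add: frob_mult gf_sub_frob distrib_right)
  hence "abs_trace s ((z + frob s z) * y) \<noteq> 0" using z by (simp only: abs_trace_half not_False_eq_True)
  hence "(\<Sum>a\<in>gf_sub s. bit_sign (abs_trace s (a * y))) = 0"
    by (intro sum_bit_sign_eq_0[where z = "z + frob s z"])
       (auto simp: half_in distrib_right abs_trace_s_add gf_sub_closed(4)[OF char_2] y intro: gf_sub_closed(3)[OF char_2])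
  thus ?thesis using False by simp
qed

end

section \<open>The quadratic forms of the code\<close>

locale trace_form = half_field s type_of_field
  for s :: nat and type_of_field :: "'a::finite_field itself" +
  fixes l :: nat
  assumes l_pos: "1 \<le> l" and l_less: "l < 2 * s" and l_neq: "l \<noteq> s"
begin

definition Q :: "'a \<Rightarrow> 'a \<Rightarrow> 'a \<Rightarrow> bit" where
  "Q a b x = abs_trace s (a * (x * frob s x)) + trace (b * (x * frob l x))"

text \<open>The linearised map that represents the polar form of \<open>Q a b\<close> through
  \<open>trace (L a b x * y)\<close>. The last summand is the adjoint term:
  \<open>frob (2 * s - l)\<close> inverts \<open>frob l\<close>.\<close>

definition L :: "'a \<Rightarrow> 'a \<Rightarrow> 'a \<Rightarrow> 'a" where
  "L a b x = a * frob s x + b * frob l x + frob (2 * s - l) (b * x)"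

text \<open>For \<open>a \<in> gf_sub s\<close> this is the radical of the polar form of
  \<open>Q a b\<close>.\<close>

definition kern :: "'a \<Rightarrow> 'a \<Rightarrow> 'a set" where
  "kern a b = {x. L a b x = 0}"

definition S :: "'a \<Rightarrow> 'a \<Rightarrow> 'a \<Rightarrow> int" where
  "S a b c = (\<Sum>x\<in>UNIV. bit_sign (Q a b x + trace (c * x)))"

definition d :: nat where "d = gcd s l"

definition d' :: nat where "d' = gcd (s + l) (2 * l)"

lemma frob_l_inv: "frob (2 * s - l) (frob l x) = (x::'a)" "frob l (frob (2 * s - l) x) = (x::'a)"
  using l_less by (simp_all add: frob_frob)

lemma L_0 [simp]: "L a b 0 = 0"
  by (simp add: L_def)

lemma L_add: "L a b (x + y) = L a b x + L a b y"
  unfolding L_def by (simp only: frob_add distrib_left ac_simps)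

lemma d_dvd: "d dvd s" "d dvd l" "d dvd 2 * s" "d dvd 2 * s - l"
  by (simp_all add: d_def)

lemma d_pos: "d > 0"
  using s_pos by (simp add: d_def)

text \<open>As \<open>2 * s + 2 * l\<close> is a multiple of \<open>s + l\<close>, the numbers
  \<open>2 * s\<close> and \<open>2 * l\<close> are interchangeable in a gcd with
  \<open>s + l\<close>. The form with \<open>2 * s\<close> describes the fixed field of
  \<open>frob (s + l)\<close>.\<close>

lemma d'_dvd: "d' dvd 2 * s" "d' = gcd (s + l) (2 * s)"
proof -
  have dvd: "gcd (s + l) (2 * x) dvd 2 * y" if "s + l = x + y" for x y
  proof -
    have "gcd (s + l) (2 * x) dvd 2 * (s + l) - 2 * x"
      by (rule dvd_diff_nat[OF dvd_mult[OF gcd_dvd1] gcd_dvd2])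
    moreover have "2 * (s + l) - 2 * x = 2 * y" using that by arith
    ultimately show ?thesis by metis
  qed
  show "d' dvd 2 * s" unfolding d'_def by (rule dvd) (rule add.commute)
  moreover have "gcd (s + l) (2 * s) dvd d'" unfolding d'_def using dvd[OF refl] by (intro gcd_greatest gcd_dvd1)
  moreover have "d' dvd s + l" by (simp add: d'_def)
  ultimately show "d' = gcd (s + l) (2 * s)" by (metis dvd_antisym gcd_greatest)
qed

lemma Q_add:
  assumes a: "a \<in> gf_sub s"
  shows "Q a b (x + y) = Q a b x + Q a b y + trace (L a b x * y)"
proof -
  \<comment> \<open>The cross terms of the norm part are \<open>z\<close> and its conjugate, so
    \<open>abs_trace s\<close> of their sum is \<open>trace z\<close>.\<close>
  define z where "z = a * frob s x * y"
  have fz: "frob s z = a * (x * frob s y)"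
    using a by (simp add: z_def frob_mult frob_s_s gf_sub_frob)
  have N: "a * (x * frob s x) \<in> gf_sub s" for x
    using gf_sub_closed(4)[OF char_2 a norm_in] .
  have "a * ((x + y) * frob s (x + y)) = a * (x * frob s x) + a * (y * frob s y) + (z + frob s z)"
    unfolding frob_add fz unfolding z_def by (simp only: distrib_left distrib_right ac_simps)
  hence 1: "abs_trace s (a * ((x + y) * frob s (x + y))) =
      abs_trace s (a * (x * frob s x)) + abs_trace s (a * (y * frob s y)) + trace z"
    using N by (simp only: abs_trace_s_add gf_sub_closed(3)[OF char_2] half_in abs_trace_half)
  have "b * ((x + y) * frob l (x + y)) =
      b * (x * frob l x) + b * (y * frob l y) + (b * frob l x * y + b * x * frob l y)"
    unfolding frob_add by (simp only: distrib_left distrib_right ac_simps)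
  \<comment> \<open>Invariance of the trace under \<open>frob (2 * s - l)\<close> frees
    \<open>y\<close> from its Frobenius.\<close>
  moreover have "trace (b * x * frob l y) = trace (frob (2 * s - l) (b * x) * y)"
    using abs_trace_m_frob[of "2 * s - l" "b * x * frob l y"]
    by (simp only: frob_mult frob_l_inv)
  ultimately have 2: "trace (b * ((x + y) * frob l (x + y))) =
      trace (b * (x * frob l x)) + trace (b * (y * frob l y)) +
      (trace (b * frob l x * y) + trace (frob (2 * s - l) (b * x) * y))"
    by (simp only: abs_trace_m_add)
  have 3: "trace (L a b x * y) = trace z + (trace (b * frob l x * y) + trace (frob (2 * s - l) (b * x) * y))"
    by (simp only: L_def z_def distrib_right abs_trace_m_add add.assoc)
  show ?thesis unfolding Q_def 1 2 3 by (simp only: ac_simps)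
qed

lemma Q_0 [simp]: "Q a b 0 = 0"
  by (simp add: Q_def)

lemma Q_linear_add:
  assumes "a \<in> gf_sub s"
  shows "Q a b (x + y) + trace (c * (x + y)) =
    (Q a b x + trace (c * x)) + (Q a b y + trace (c * y)) + trace (L a b x * y)"
  by (simp only: Q_add[OF assms] distrib_left abs_trace_m_add add.assoc add.left_commute add.commute)

lemma S_square:
  assumes "a \<in> gf_sub s"
  shows "(S a b c)\<^sup>2 \<in> {0, 2 ^ (2 * s) * int (card (kern a b))}"
  unfolding S_def kern_def
  by (rule quadratic_sum_square[where L = "L a b"]) (rule Q_linear_add[OF assms] L_0 L_add)+

text \<open>Parseval: after the squares are written as sums over \<open>kern a b\<close>, summation
  over \<open>c\<close> leaves only the term \<open>y = 0\<close>.\<close>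

lemma sum_S_square:
  assumes "a \<in> gf_sub s"
  shows "(\<Sum>c\<in>UNIV. (S a b c)\<^sup>2) = 2 ^ (2 * s) * 2 ^ (2 * s)"
proof -
  have "(S a b c)\<^sup>2 = 2 ^ (2 * s) * (\<Sum>y\<in>kern a b. bit_sign (Q a b y + trace (c * y)))" for c
    unfolding S_def kern_def by (rule quadratic_sum_square_eq[where L = "L a b"]) (rule Q_linear_add[OF assms])
  hence "(\<Sum>c\<in>UNIV. (S a b c)\<^sup>2) =
      2 ^ (2 * s) * (\<Sum>c\<in>UNIV. \<Sum>y\<in>kern a b. bit_sign (Q a b y) * bit_sign (trace (c * y)))"
    by (simp only: bit_sign_add sum_distrib_left)
  also have "(\<Sum>c\<in>UNIV. \<Sum>y\<in>kern a b. bit_sign (Q a b y) * bit_sign (trace (c * y))) =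
      (\<Sum>y\<in>kern a b. bit_sign (Q a b y) * (\<Sum>c\<in>UNIV. bit_sign (trace (c * y))))"
    by (subst sum.swap) (simp only: sum_distrib_left)
  also have "\<dots> = (\<Sum>y\<in>kern a b. if y = 0 then 2 ^ (2 * s) else 0)"
    by (rule sum.cong) (simp_all add: sum_bit_sign_abs_trace_m)
  also have "\<dots> = 2 ^ (2 * s)" by (simp add: kern_def)
  finally show ?thesis .
qed

text \<open>All nonzero squares have the same value, so their sum counts them.\<close>

lemma card_S_nonzero:
  assumes "a \<in> gf_sub s"
  shows "card {c. S a b c \<noteq> 0} * card (kern a b) = 2 ^ (2 * s)"
proof -
  have "(\<Sum>c\<in>UNIV. (S a b c)\<^sup>2) = (\<Sum>c\<in>UNIV. if S a b c \<noteq> 0 then 2 ^ (2 * s) * int (card (kern a b)) else 0)"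
  proof (rule sum.cong[OF refl])
    fix c show "(S a b c)\<^sup>2 = (if S a b c \<noteq> 0 then 2 ^ (2 * s) * int (card (kern a b)) else 0)"
      using S_square[OF assms, of b c] by auto
  qed
  also have "\<dots> = int (card {c. S a b c \<noteq> 0}) * (2 ^ (2 * s) * int (card (kern a b)))"
    by (simp only: sum.If_cases finite sum_constant) simp
  finally have "2 ^ (2 * s) * 2 ^ (2 * s) = 2 ^ (2 * s) * int (card {c. S a b c \<noteq> 0} * card (kern a b))"
    using sum_S_square[OF assms, of b] by (simp only: of_nat_mult ac_simps)
  hence "2 ^ (2 * s) = int (card {c. S a b c \<noteq> 0} * card (kern a b))" by simp
  hence "int (2 ^ (2 * s)) = int (card {c. S a b c \<noteq> 0} * card (kern a b))" by simp
  thus ?thesis by (simp only: of_nat_eq_iff)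
qed

text \<open>The form \<open>B\<close> is alternating over \<open>gf_sub d\<close> and has radical
  \<open>kern a b\<close>. Its rank is an even number \<open>2 * j\<close>, which gives
  \<open>k = s - d * j\<close>.\<close>

lemma card_kern:
  assumes a: "a \<in> gf_sub s"
  obtains k where "d dvd k" "k \<le> s" "card (kern a b) = 2 ^ (2 * k)"
proof -
  define B where "B = (\<lambda>x y. rel_trace d (L a b x * y))"
  have B_eq: "B x y = rel_trace d (a * frob s x * y) + (rel_trace d (b * frob l x * y) + rel_trace d (b * x * frob l y))" for x y
  proof -
    have "rel_trace d (b * x * frob l y) = rel_trace d (frob (2 * s - l) (b * x) * y)"
      using rel_trace_frob[of d "2 * s - l" "b * x * frob l y"] d_dvd
      by (simp only: frob_mult frob_l_inv)
    thus ?thesis by (simp only: B_def L_def distrib_right rel_trace_add add.assoc)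
  qed
  have sym: "B x y = B y x" for x y
  proof -
    have "rel_trace d (a * frob s x * y) = rel_trace d (frob s (a * frob s x * y))"
      using d_dvd by (simp only: rel_trace_frob)
    also have "frob s (a * frob s x * y) = a * frob s y * x"
      using a by (simp add: frob_mult frob_s_s gf_sub_frob ac_simps)
    finally show ?thesis unfolding B_eq by (simp only: ac_simps)
  qed
  \<comment> \<open>In characteristic two this does not follow from symmetry. The norm term lies in
    \<open>gf_sub s\<close>, hence equals some \<open>z + frob s z\<close>, whose trace vanishes;
    the other two terms coincide and cancel.\<close>
  have alt: "B x x = 0" for x
  proof -
    obtain z where z: "a * (x * frob s x) = z + frob s z"
      using half_surj[OF gf_sub_closed(4)[OF char_2 a norm_in]] .
    have "rel_trace d (a * frob s x * x) = rel_trace d (z + frob s z)"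
      by (simp only: z[symmetric] ac_simps)
    also have "\<dots> = 0" using d_dvd by (simp only: rel_trace_add rel_trace_frob add_self)
    finally show ?thesis unfolding B_eq by (simp only: ac_simps add_self add_0_right)
  qed
  have fix_frob: "frob k t = t" if "t \<in> gf_sub d" "d dvd k" for t :: 'a and k
    using that frob_fixed_mult[of d t] by (auto simp: gf_sub_frob)
  have L_scale: "L a b (t * x) = t * L a b x" if "t \<in> gf_sub d" for t x
    unfolding L_def frob_mult fix_frob[OF that d_dvd(1)] fix_frob[OF that d_dvd(2)] fix_frob[OF that d_dvd(4)]
    by (simp only: distrib_left ac_simps)
  obtain j where j: "card (UNIV :: 'a set) = (2 ^ d) ^ (2 * j) * card {x \<in> UNIV. \<forall>y\<in>UNIV. B x y = 0}"
  proof (atomize_elim, rule card_alternating_radical[OF d_dvd(3)])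
    show "B (x + y) z = B x z + B y z" for x y z
      by (simp only: B_def L_add distrib_right rel_trace_add)
    show "B (t * x) z = t * B x z" if "t \<in> gf_sub d" for t x z
      by (simp only: B_def L_scale[OF that] mult.assoc rel_trace_scale[OF that])
    show "B x y \<in> gf_sub d" for x y
      unfolding B_def by (rule rel_trace_in_gf_sub[OF d_dvd(3)])
  qed (simp_all add: sym alt)
  have keq: "{x \<in> UNIV. \<forall>y\<in>UNIV. B x y = 0} = kern a b"
    using rel_trace_nondegenerate[OF d_dvd(3)] by (auto simp: B_def kern_def)
  have eq: "2 ^ (2 * s) = (2::nat) ^ (2 * (d * j)) * card (kern a b)"
  proof -
    have "((2::nat) ^ d) ^ (2 * j) = 2 ^ (2 * (d * j))"
      by (simp only: power_mult[symmetric] mult.left_commute)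
    thus ?thesis using j by (simp only: card_field keq)
  qed
  hence "(2::nat) ^ (2 * (d * j)) dvd 2 ^ (2 * s)" by (metis dvd_triv_left)
  hence le: "d * j \<le> s" by (simp add: dvd_power_iff_le)
  hence "(2::nat) ^ (2 * s) = 2 ^ (2 * (d * j)) * 2 ^ (2 * (s - d * j))"
    by (simp only: power_add[symmetric] distrib_left[symmetric] le_add_diff_inverse)
  hence "card (kern a b) = 2 ^ (2 * (s - d * j))" using eq by simp
  moreover have "d dvd s - d * j" by (simp add: d_dvd)
  ultimately show ?thesis using that by simp
qed

text \<open>For \<open>b \<noteq> 0\<close>, \<open>frob l\<close> turns \<open>L a b x = 0\<close>
  into an equation of degree 2 in \<open>frob (s + l)\<close>, whose fixed field has
  \<open>2^d'\<close> elements. For \<open>b = 0\<close> the kernel is trivial.\<close>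

lemma card_kern_le:
  assumes a: "a \<in> gf_sub s" and nz: "(a, b) \<noteq> (0, 0)"
  shows "card (kern a b) \<le> 2 ^ (2 * d')"
proof (cases "b = 0")
  case True
  hence "kern a b = {0}" using nz by (auto simp: kern_def L_def)
  thus ?thesis by simp
next
  case False
  have "gf_sub (s + l) = (gf_sub d' :: 'a set)"
    using gf_sub_gcd[of "s + l" "2 * s"] by (simp add: gf_sub_m d'_dvd(2))
  hence c: "card (gf_sub (s + l) :: 'a set) = 2 ^ d'"
    using card_gf_sub_dvd[OF d'_dvd(1)] by simp
  have "kern a b \<subseteq> {x. frob l b * frob (2 * (s + l)) x + frob l a * frob (s + l) x + b * x = 0}"
  proof
    fix x assume "x \<in> kern a b"
    hence "frob l (L a b x) = 0" by (simp add: kern_def)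
    \<comment> \<open>\<open>frob (2 * s)\<close> is the identity, so \<open>frob (2 * l)\<close> is
      the square of \<open>frob (s + l)\<close>.\<close>
    moreover have "frob (2 * (s + l)) x = frob (2 * l) (frob (2 * s) x)"
      unfolding frob_frob by (simp add: distrib_left add.commute)
    hence "frob (2 * (s + l)) x = frob (2 * l) x" by simp
    moreover have "frob l (L a b x) = frob l b * frob (2 * l) x + frob l a * frob (s + l) x + b * x"
      unfolding L_def frob_add frob_mult[of l] frob_l_inv(2) unfolding frob_frob mult_2 by (simp only: ac_simps)
    ultimately show "x \<in> {x. frob l b * frob (2 * (s + l)) x + frob l a * frob (s + l) x + b * x = 0}"
      by simp
  qed
  hence "card (kern a b) \<le> card {x. frob l b * frob (2 * (s + l)) x + frob l a * frob (s + l) x + b * x = 0}"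
    by (intro card_mono) auto
  also have "\<dots> \<le> (card (gf_sub (s + l) :: 'a set))\<^sup>2"
    using False by (intro card_frob_quadratic_kernel_le) auto
  also have "\<dots> = 2 ^ (2 * d')" by (simp add: c power_mult[symmetric] mult.commute)
  finally show ?thesis .
qed

end

lemma odd_power_plus_one_dvd:
  assumes "odd k"
  shows "(y + 1 :: int) dvd y ^ k + 1"
proof -
  have "y + 1 dvd y ^ (2 * j + 1) + 1" for j
  proof (induction j)
    case (Suc j)
    have "y ^ (2 * Suc j + 1) + 1 = y\<^sup>2 * (y ^ (2 * j + 1) + 1) - (y + 1) * (y - 1)"
      by (simp add: power2_eq_square algebra_simps)
    thus ?case using Suc by (metis dvd_diff dvd_mult dvd_triv_left)
  qed simp
  thus ?thesis using assms by (elim oddE) simp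
qed

lemma odd_power_plus_one_dvd_nat:
  assumes "odd k"
  shows "y + 1 dvd (y::nat) ^ k + 1"
proof -
  have "int (y + 1) dvd int (y ^ k + 1)" using odd_power_plus_one_dvd[OF assms, of "int y"] by (simp add: add.commute)
  thus ?thesis by (simp only: int_dvd_int_iff)
qed

section \<open>Sums over all pairs \<open>(a, b)\<close>\<close>

context trace_form
begin

abbreviation P :: "('a \<times> 'a) set" where "P \<equiv> gf_sub s \<times> UNIV"

lemma gf_sub_d: "gf_sub d = gf_sub s \<inter> (gf_sub l :: 'a set)"
  by (simp add: gf_sub_gcd d_def)

lemma card_gf_sub_d: "card (gf_sub d :: 'a set) = 2 ^ d"
  by (rule card_gf_sub_dvd[OF d_dvd(3)])

text \<open>Each of the \<open>2^d\<close> values has \<open>2^s\<close> preimages under the trace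
  onto \<open>gf_sub s\<close>. These \<open>u\<close> parametrise the pairs \<open>(a, b)\<close>
  with a prescribed \<open>x \<noteq> 0\<close> in the radical.\<close>

lemma card_conj_sum_in_gf_sub_d: "card {u::'a. u + frob s u \<in> gf_sub d} = 2 ^ (s + d)"
proof -
  have "card (\<Union>v\<in>gf_sub d. {u::'a. u + frob s u = v}) = (\<Sum>v\<in>gf_sub d. card {u::'a. u + frob s u = v})"
    by (rule card_UN_disjoint) auto
  also have "\<dots> = (\<Sum>v\<in>(gf_sub d :: 'a set). 2 ^ s)"
    by (rule sum.cong) (auto simp: gf_sub_d half_fibre)
  also have "\<dots> = 2 ^ (s + d)" by (simp add: card_gf_sub_d power_add)
  also have "(\<Union>v\<in>gf_sub d. {u::'a. u + frob s u = v}) = {u. u + frob s u \<in> gf_sub d}" by auto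
  finally show ?thesis .
qed

text \<open>The operators \<open>1 + frob s\<close> and \<open>1 + frob (2 * s - l)\<close> commute,
  and \<open>gf_sub s\<close> is the kernel of the first. So both sides say that
  \<open>v = u + frob s u\<close> is fixed by \<open>frob l\<close>.\<close>

lemma conj_sum_in_gf_sub_d_iff:
  "u + frob s u \<in> gf_sub d \<longleftrightarrow> u + frob (2 * s - l) u \<in> gf_sub s" for u :: 'a
proof -
  define v where "v = u + frob s u"
  have "u + frob (2 * s - l) u \<in> gf_sub s \<longleftrightarrow>
      frob s u + frob s (frob (2 * s - l) u) + (u + frob (2 * s - l) u) = 0"
    by (simp only: gf_sub_frob frob_add add_eq_0_iff)
  also have "frob s u + frob s (frob (2 * s - l) u) + (u + frob (2 * s - l) u) =
      v + frob (2 * s - l) v"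
    unfolding v_def frob_add frob_frob by (simp only: ac_simps)
  also have "v + frob (2 * s - l) v = 0 \<longleftrightarrow> frob l v = v"
    by (metis add_eq_0_iff frob_l_inv)
  also have "\<dots> \<longleftrightarrow> v \<in> gf_sub d"
    using half_in[of u] by (simp add: gf_sub_d v_def gf_sub_frob)
  finally show ?thesis by (simp add: v_def)
qed

text \<open>Multiplying by \<open>x\<close> turns \<open>L a b x = 0\<close> into an equation linear in \<open>a\<close> and
  \<open>b * (x * frob l x)\<close>, so its solutions \<open>(a, b)\<close> can be counted for each fixed \<open>x\<close>.\<close>
lemma L_eq_0_iff:
  fixes a b x :: 'a
  assumes "x \<noteq> 0"
  defines "u \<equiv> b * (x * frob l x)"
  shows "L a b x = 0 \<longleftrightarrow> a * (x * frob s x) = u + frob (2 * s - l) u"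
proof -
  have "frob (2 * s - l) u = x * frob (2 * s - l) (b * x)"
    unfolding u_def frob_mult frob_l_inv by (simp only: ac_simps)
  hence "x * L a b x = a * (x * frob s x) + (u + frob (2 * s - l) u)"
    unfolding L_def u_def by (simp only: distrib_left ac_simps)
  moreover have "L a b x = 0 \<longleftrightarrow> x * L a b x = 0" using assms by simp
  ultimately show ?thesis by (simp only: add_eq_0_iff)
qed

text \<open>The value \<open>u = b * (x * frob l x)\<close> determines \<open>b\<close>, and then
  the equation determines \<open>a\<close>. The only constraint on \<open>u\<close> is that this
  \<open>a\<close> lies in \<open>gf_sub s\<close>; the norm \<open>x * frob s x\<close> already
  does.\<close>

lemma card_L_eq_0:
  assumes x: "x \<noteq> 0"
  shows "card {p \<in> P. L (fst p) (snd p) x = 0} = 2 ^ (s + d)"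
proof -
  let ?f = "\<lambda>p :: 'a \<times> 'a. snd p * (x * frob l x)"
  let ?g = "\<lambda>u. ((u + frob (2 * s - l) u) / (x * frob s x), u / (x * frob l x))"
  have nz: "x * frob s x \<noteq> 0" "x * frob l x \<noteq> 0" using x by simp_all
  have "bij_betw ?f {p \<in> P. L (fst p) (snd p) x = 0} {u. u + frob s u \<in> gf_sub d}"
  proof (rule bij_betw_byWitness[where f' = ?g])
    show "\<forall>p\<in>{p \<in> P. L (fst p) (snd p) x = 0}. ?g (?f p) = p"
    proof
      fix p assume "p \<in> {p \<in> P. L (fst p) (snd p) x = 0}"
      hence "fst p * (x * frob s x) = ?f p + frob (2 * s - l) (?f p)"
        using L_eq_0_iff[OF x] by blast
      hence "fst p = (?f p + frob (2 * s - l) (?f p)) / (x * frob s x)"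
        using nz by (metis nonzero_mult_div_cancel_right)
      moreover have "snd p = ?f p / (x * frob l x)" using nz by (metis nonzero_mult_div_cancel_right)
      ultimately show "?g (?f p) = p" by (metis prod.collapse)
    qed
    show "\<forall>u\<in>{u. u + frob s u \<in> gf_sub d}. ?f (?g u) = u" using nz by simp
    show "?f ` {p \<in> P. L (fst p) (snd p) x = 0} \<subseteq> {u. u + frob s u \<in> gf_sub d}"
    proof (rule image_subsetI)
      fix p assume p: "p \<in> {p \<in> P. L (fst p) (snd p) x = 0}"
      hence "fst p * (x * frob s x) = ?f p + frob (2 * s - l) (?f p)"
        using L_eq_0_iff[OF x] by blast
      moreover have "fst p * (x * frob s x) \<in> gf_sub s"
        using p by (intro gf_sub_closed(4)[OF char_2 _ norm_in]) auto
      ultimately have "?f p + frob (2 * s - l) (?f p) \<in> gf_sub s" by metis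
      thus "?f p \<in> {u. u + frob s u \<in> gf_sub d}" by (simp only: conj_sum_in_gf_sub_d_iff mem_Collect_eq)
    qed
    show "?g ` {u. u + frob s u \<in> gf_sub d} \<subseteq> {p \<in> P. L (fst p) (snd p) x = 0}"
    proof (rule image_subsetI)
      fix u :: 'a assume "u \<in> {u. u + frob s u \<in> gf_sub d}"
      hence "u + frob (2 * s - l) u \<in> gf_sub s" by (simp only: conj_sum_in_gf_sub_d_iff mem_Collect_eq)
      hence "(u + frob (2 * s - l) u) * inverse (x * frob s x) \<in> gf_sub s"
        by (rule gf_sub_closed(4)[OF char_2 _ gf_sub_closed(5)[OF char_2 norm_in]])
      hence "fst (?g u) \<in> gf_sub s" by (simp only: fst_conv divide_inverse)
      moreover have "L (fst (?g u)) (snd (?g u)) x = 0"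
        unfolding L_eq_0_iff[OF x] using nz by simp
      ultimately show "?g u \<in> {p \<in> P. L (fst p) (snd p) x = 0}"
        by (simp only: mem_Collect_eq mem_Times_iff UNIV_I simp_thms)
    qed
  qed
  from bij_betw_same_card[OF this] show ?thesis by (simp only: card_conj_sum_in_gf_sub_d)
qed

lemma card_P: "card P = 2 ^ (3 * s)"
proof -
  have "3 * s = s + 2 * s" by simp
  thus ?thesis by (simp only: card_cartesian_product card_half card_field power_add)
qed

text \<open>Double counting of the triples \<open>(a, b, x)\<close> with \<open>L a b x = 0\<close>:
  all pairs for \<open>x = 0\<close>, and \<open>2^(s + d)\<close> pairs for every other
  \<open>x\<close>.\<close>

lemma sum_card_kern:
  "(\<Sum>p\<in>P. card (kern (fst p) (snd p))) = 2 ^ (3 * s) + (2 ^ (2 * s) - 1) * 2 ^ (s + d)"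
proof -
  have "(\<Sum>p\<in>P. card (kern (fst p) (snd p))) = (\<Sum>p\<in>P. \<Sum>x\<in>UNIV. if L (fst p) (snd p) x = 0 then 1 else 0)"
    by (rule sum.cong) (simp_all add: kern_def sum.If_cases)
  also have "\<dots> = (\<Sum>x\<in>UNIV. \<Sum>p\<in>P. if L (fst p) (snd p) x = 0 then 1 else 0)"
    by (rule sum.swap)
  also have "\<dots> = (\<Sum>x\<in>UNIV. card {p \<in> P. L (fst p) (snd p) x = 0})"
    by (rule sum.cong) (simp_all add: sum.If_cases Int_def)
  also have "\<dots> = card {p \<in> P. L (fst p) (snd p) 0 = 0} + (\<Sum>x\<in>UNIV - {0}. card {p \<in> P. L (fst p) (snd p) x = 0})"
    by (rule sum.remove) auto
  also have "{p \<in> P. L (fst p) (snd p) 0 = 0} = P" by auto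
  also have "(\<Sum>x\<in>UNIV - {0}. card {p \<in> P. L (fst p) (snd p) x = 0}) = (\<Sum>x\<in>UNIV - {0::'a}. 2 ^ (s + d))"
    by (rule sum.cong) (auto simp: card_L_eq_0)
  also have "\<dots> = (2 ^ (2 * s) - 1) * 2 ^ (s + d)" by (simp add: card_Diff_singleton card_field)
  finally show ?thesis by (simp only: card_P)
qed

text \<open>For fixed \<open>x\<close> the sum over \<open>(a, b)\<close> is a product of two
  character sums, which vanish unless \<open>x = 0\<close>.\<close>

lemma sum_S: "(\<Sum>p\<in>P. S (fst p) (snd p) 0) = 2 ^ (3 * s)"
proof -
  have "(\<Sum>p\<in>P. S (fst p) (snd p) 0) = (\<Sum>p\<in>P. \<Sum>x\<in>UNIV. bit_sign (Q (fst p) (snd p) x))"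
    by (simp only: S_def mult_zero_left abs_trace_m_0 add_0_right)
  also have "\<dots> = (\<Sum>x\<in>UNIV. \<Sum>p\<in>P. bit_sign (Q (fst p) (snd p) x))"
    by (rule sum.swap)
  also have "\<dots> = (\<Sum>x\<in>UNIV. (\<Sum>a\<in>gf_sub s. bit_sign (abs_trace s (a * (x * frob s x)))) *
      (\<Sum>b\<in>UNIV. bit_sign (trace (b * (x * frob l x)))))"
    by (simp only: Q_def bit_sign_add sum_product sum.cartesian_product split_def)
  also have "\<dots> = (\<Sum>x\<in>UNIV. if x = (0::'a) then 2 ^ s * 2 ^ (2 * s) else 0)"
    by (rule sum.cong) (simp_all add: sum_bit_sign_abs_trace_m sum_bit_sign_abs_trace_s[OF norm_in])
  also have "\<dots> = 2 ^ s * 2 ^ (2 * s)" by simp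
  also have "\<dots> = 2 ^ (s + 2 * s)" by (simp only: power_add)
  finally show ?thesis by simp
qed

section \<open>The sign of the sums when \<open>d' = 2 * d\<close>\<close>

context
  assumes d'_eq: "d' = 2 * d"
begin

text \<open>The quotients are coprime, and \<open>2 * d dvd s + l\<close> makes their sum even, so
  neither is even.\<close>

lemma quotients_odd: "odd (s div d)" "odd (l div d)"
proof -
  obtain s' l' where sl: "s = s' * d" "l = l' * d" "coprime s' l'"
    using gcd_coprime_exists[of s l] d_pos by (auto simp: d_def)
  have "2 * d dvd (s' + l') * d" using d'_eq sl by (metis d'_def distrib_right gcd_dvd1)
  hence ev: "even (s' + l')" using d_pos by simp
  have "\<not> (even s' \<and> even l')" using sl(3) by (metis coprime_common_divisor_nat even_iff_mod_2_eq_zero dvd_def odd_one coprime_common_divisor)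
  with ev have "odd s' \<and> odd l'" by auto
  moreover have "s div d = s'" "l div d = l'" 
    using sl(1,2) d_pos by (metis nonzero_mult_div_cancel_right less_not_refl)+
  ultimately show "odd (s div d)" "odd (l div d)" by simp_all
qed

lemma dvd_power_plus_one:
  assumes "odd (k div d)" "d dvd k"
  shows "2 ^ d + 1 dvd 2 ^ k + (1::nat)"
  using odd_power_plus_one_dvd_nat[OF assms(1), of "2 ^ d"] assms(2) by (simp flip: power_mult)

text \<open>A nonempty fibre is a coset of the group of roots of unity of order dividing
  \<open>2^d + 1\<close>. This group has full size, as \<open>2^d + 1\<close> divides
  \<open>2^s + 1\<close> and hence \<open>2^(2*s) - 1\<close>.\<close>

lemma card_power_fibre_dvd:
  assumes "y \<noteq> 0"
  shows "2 ^ d + 1 dvd card {x :: 'a. x ^ (2 ^ d + 1) = y}"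
proof (cases "{x :: 'a. x ^ (2 ^ d + 1) = y} = {}")
  case True
  thus ?thesis by (simp only: card.empty dvd_0_right)
next
  case False
  then obtain z where z: "z ^ (2 ^ d + 1) = y" by blast
  hence z0: "z \<noteq> 0" using assms by auto
  have "2 ^ d + 1 dvd (2 ^ s + 1) * (2 ^ s - 1 :: nat)"
    using dvd_power_plus_one[OF quotients_odd(1) d_dvd(1)] by (rule dvd_mult2)
  also have "(2 ^ s + 1) * (2 ^ s - 1 :: nat) = CARD('a) - 1"

    unfolding card_field mult_2[of s] power_add by (simp add: algebra_simps)
  finally have roots: "card {x::'a. x ^ (2 ^ d + 1) = 1} = 2 ^ d + 1"
    by (intro card_roots_of_unity) simp_all
  have "bij_betw (\<lambda>x. x * z) {x::'a. x ^ (2 ^ d + 1) = 1} {x. x ^ (2 ^ d + 1) = y}"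
    by (rule bij_betw_byWitness[where f' = "\<lambda>x. x / z"])
       (use z z0 assms in \<open>auto simp only: power_mult_distrib power_divide mult_1_left divide_self simp_thms nonzero_mult_div_cancel_right nonzero_divide_eq_eq mem_Collect_eq times_divide_eq_left\<close>)
  from bij_betw_same_card[OF this] show ?thesis by (simp only: roots) simp
qed

text \<open>\<open>Q\<close> factors through \<open>x \<mapsto> x^(2^d+1)\<close>, whose fibres over nonzero values have
  \<open>0\<close> or \<open>2^d+1\<close> elements.\<close>
lemma S_mod: "2 ^ d + 1 dvd S a b 0 - 1"
proof -
  let ?n = "2 ^ d + 1 :: nat"
  obtain e1 e2 where e: "2 ^ s + 1 = ?n * e1" "2 ^ l + 1 = ?n * e2"
    using dvd_power_plus_one[OF quotients_odd(1) d_dvd(1)] dvd_power_plus_one[OF quotients_odd(2) d_dvd(2)]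
    by (metis dvdE)
  have pow: "x * frob k x = x ^ (2 ^ k + 1)" for x :: 'a and k by (simp add: frob_def)
  define G where "G = (\<lambda>y. abs_trace s (a * y ^ e1) + trace (b * y ^ e2))"
  have QG: "Q a b x = G (x ^ ?n)" for x
    unfolding Q_def G_def pow e power_mult ..
  have "S a b 0 = (\<Sum>x\<in>UNIV. bit_sign (G (x ^ ?n)))" by (simp only: S_def QG mult_zero_left abs_trace_m_0 add_0_right)
  also have "\<dots> = (\<Sum>y\<in>UNIV. \<Sum>x | x \<in> UNIV \<and> x ^ ?n = y. bit_sign (G (x ^ ?n)))"
    by (rule sum.group[symmetric]) auto
  also have "\<dots> = (\<Sum>y\<in>UNIV. int (card {x. x ^ ?n = y}) * bit_sign (G y))"
    by (rule sum.cong) simp_all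
  \<comment> \<open>The fibre over \<open>0\<close> is a single point with sign \<open>1\<close>; it
    accounts for the \<open>1\<close> in the congruence.\<close>
  also have "\<dots> = int (card {x::'a. x ^ ?n = 0}) * bit_sign (G 0) +
      (\<Sum>y\<in>UNIV - {0}. int (card {x. x ^ ?n = y}) * bit_sign (G y))"
    by (rule sum.remove) auto
  also have "{x::'a. x ^ ?n = 0} = {0}" by (auto simp only: power_eq_0_iff)
  also have "G 0 = 0" using QG[of 0] by (simp only: Q_0 power_0_left) simp
  finally have "S a b 0 - 1 = (\<Sum>y\<in>UNIV - {0}. int (card {x. x ^ ?n = y}) * bit_sign (G y))"
    by simp
  moreover have "int ?n dvd (\<Sum>y\<in>UNIV - {0}. int (card {x. x ^ ?n = y}) * bit_sign (G y))"
    by (rule dvd_sum, rule dvd_mult2, subst int_dvd_int_iff, rule card_power_fibre_dvd) simp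
  ultimately have "int ?n dvd S a b 0 - 1" by metis
  moreover have "int ?n = 2 ^ d + 1" by simp
  ultimately show ?thesis by metis
qed

text \<open>Since \<open>2^d \<equiv> -1\<close> modulo \<open>2^d+1\<close>, the congruence singles out one of the two square roots.\<close>
lemma S_value:
  assumes a: "a \<in> gf_sub s" and k: "card (kern a b) = 2 ^ (2 * (d * i))"
  shows "S a b 0 = - ((- 1) ^ i * 2 ^ (s + d * i))"
proof -
  let ?n = "2 ^ d + 1 :: int"
  have "(2::int) ^ d \<ge> 2 ^ 1" using d_pos by (intro power_increasing) auto
  hence n: "?n > 2" by simp
  have "S a b 0 \<noteq> 0"
  proof
    assume "S a b 0 = 0"
    hence "?n dvd - 1" using S_mod[of a b] by simp
    hence "?n dvd 1" by (simp only: dvd_minus_iff)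
    from zdvd_imp_le[OF this] n show False by simp
  qed
  hence "(S a b 0)\<^sup>2 = 2 ^ (2 * s) * int (card (kern a b))"
    using S_square[OF a, of b 0] by auto
  also have "\<dots> = ((- 1) ^ i * 2 ^ (s + d * i))\<^sup>2"
    by (simp add: k power_mult_distrib power_add flip: power_mult) (simp add: mult_ac)
  finally have "S a b 0 = (- 1) ^ i * 2 ^ (s + d * i) \<or> ?thesis"
    by (simp only: power2_eq_iff)
  moreover have "S a b 0 \<noteq> (- 1) ^ i * 2 ^ (s + d * i)"
  proof
    assume S: "S a b 0 = (- 1) ^ i * 2 ^ (s + d * i)"
    have "?n dvd (2 ^ d) ^ (s div d) + 1" by (rule odd_power_plus_one_dvd[OF quotients_odd(1)])
    hence 1: "?n dvd 2 ^ s + 1" using d_dvd(1) by (simp flip: power_mult)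
    have 2: "?n dvd (- 1) ^ i * 2 ^ (d * i) - 1"
    proof (induction i)
      case (Suc i)
      have "(- 1) ^ Suc i * 2 ^ (d * Suc i) - (1::int) =
          - (2 ^ d) * ((- 1) ^ i * 2 ^ (d * i) - 1) - ?n"
        by (simp add: power_add algebra_simps)
      thus ?case using Suc by (metis dvd_diff dvd_mult dvd_refl)
    qed simp
    \<comment> \<open>With this sign \<open>S a b 0\<close> would be congruent to \<open>-1\<close>,
      because \<open>2^s\<close> is and \<open>(-1)^i * 2^(d * i)\<close> is congruent to
      \<open>1\<close>. As it is also congruent to \<open>1\<close>, the modulus would divide
      \<open>2\<close>.\<close>
    have "S a b 0 - 1 = (2 ^ s + 1) * ((- 1) ^ i * 2 ^ (d * i)) - ((- 1) ^ i * 2 ^ (d * i) - 1) - 2"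
      by (simp add: S power_add algebra_simps)
    hence "2 = (2 ^ s + 1) * ((- 1) ^ i * 2 ^ (d * i)) - ((- 1) ^ i * 2 ^ (d * i) - 1) - (S a b 0 - 1)"
      by simp
    hence "?n dvd 2" using 1 2 S_mod[of a b] by (metis dvd_diff dvd_mult2)
    from zdvd_imp_le[OF this] n show False by simp
  qed
  ultimately show ?thesis by simp
qed

end

end

section \<open>Codewords and weights\<close>

lemma UNIV_bit: "UNIV = {0, 1 :: bit}"
  by (auto intro: bit.exhaust)

instance bit :: finite
  by standard (simp add: UNIV_bit)

text \<open>A new independent vector \<open>b\<close> doubles the span: the translate by
  \<open>b\<close> is disjoint from the old span and has the same size.\<close>

lemma card_span_bit:
  fixes B :: "(bit ^ 'n::finite) set"
  assumes "finite B" "vec.independent B"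
  shows "card (vec.span B) = 2 ^ card B"
  using assms
proof (induction B rule: finite_induct)
  case empty
  show ?case by simp
next
  case (insert b B)
  have ind: "vec.independent B" and b: "b \<notin> vec.span B"
    using insert.prems insert.hyps(2) by (simp_all add: vec.independent_insert)
  have "vec.span (insert b B) = vec.span B \<union> (\<lambda>y. y + b) ` vec.span B"
  proof (intro equalityI subsetI)
    fix y assume "y \<in> vec.span (insert b B)"
    then obtain k where k: "y - k *s b \<in> vec.span B"
      unfolding vec.span_breakdown_eq by blast
    show "y \<in> vec.span B \<union> (\<lambda>y. y + b) ` vec.span B"
    proof (cases k)
      case zero
      thus ?thesis using k by simp
    next
      case one
      hence "y = (y - k *s b) + b" by simp
      thus ?thesis using k by blast
    qed
  next
    fix y assume "y \<in> vec.span B \<union> (\<lambda>y. y + b) ` vec.span B"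
    moreover have "vec.span B \<subseteq> vec.span (insert b B)" by (rule vec.span_mono) auto
    moreover have "b \<in> vec.span (insert b B)" by (rule vec.span_base) simp
    ultimately show "y \<in> vec.span (insert b B)" by (auto intro: vec.span_add)
  qed
  moreover have "vec.span B \<inter> (\<lambda>y. y + b) ` vec.span B = {}"
    using b by (auto simp: vec.span_add_eq)
  moreover have "card ((\<lambda>y. y + b) ` vec.span B) = card (vec.span B)"
    by (rule card_image) simp
  ultimately show ?case using insert.IH[OF ind] insert.hyps by (simp add: card_Un_disjoint)
qed

lemma card_subspace_bit:
  fixes V :: "(bit ^ 'n::finite) set"
  assumes "vec.subspace V"
  shows "card V = 2 ^ vec.dim V"
proof -
  obtain B where B: "B \<subseteq> V" "vec.independent B" "V \<subseteq> vec.span B" "card B = vec.dim V"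
    by (rule vec.basis_exists)
  have "vec.span B = V" using B(1,3) vec.span_minimal[OF B(1) assms] by auto
  thus ?thesis using card_span_bit[OF _ B(2)] B(4) by simp
qed

lemma sum_bit_sign_eq_hamming_weight:
  fixes v :: "bit ^ 'n::finite"
  shows "(\<Sum>i\<in>UNIV. bit_sign (v $ i)) = int CARD('n) - 2 * int (hamming_weight v)"
proof -
  have "(\<Sum>i\<in>UNIV. bit_sign (v $ i)) = (\<Sum>i\<in>UNIV. 1 - (if v $ i \<noteq> 0 then 2 else 0))"
    by (rule sum.cong) (simp_all add: bit_sign_def)
  also have "\<dots> = int CARD('n) - 2 * int (hamming_weight v)"
    by (simp add: sum_subtractf sum.If_cases hamming_weight_def)
  finally show ?thesis .
qed

section \<open>Radical dimensions and the parametrisation of the codewords\<close>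

context trace_form
begin

text \<open>Half the dimension of the radical over the prime field; the description is proper on
  \<open>P\<close> by \<open>card_kern\<close>.\<close>

definition kdim :: "'a \<times> 'a \<Rightarrow> nat" where
  "kdim p = (THE k. card (kern (fst p) (snd p)) = 2 ^ (2 * k))"

lemma kdim_eqI: "card (kern (fst p) (snd p)) = 2 ^ (2 * k) \<Longrightarrow> kdim p = k"
  unfolding kdim_def by (rule the_equality) simp_all

lemma kdim:
  assumes "p \<in> P"
  shows "card (kern (fst p) (snd p)) = 2 ^ (2 * kdim p)" "d dvd kdim p" "kdim p \<le> s"
proof -
  have "fst p \<in> gf_sub s" using assms by auto
  then obtain k where k: "d dvd k" "k \<le> s" "card (kern (fst p) (snd p)) = 2 ^ (2 * k)"
    by (rule card_kern)
  with kdim_eqI[OF k(3)] show "card (kern (fst p) (snd p)) = 2 ^ (2 * kdim p)" "d dvd kdim p" "kdim p \<le> s"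
    by simp_all
qed

lemma kdim_le:
  assumes "p \<in> P" "p \<noteq> (0, 0)"
  shows "kdim p \<le> d'"
proof -
  have "fst p \<in> gf_sub s" "(fst p, snd p) \<noteq> (0, 0)" using assms by auto
  from card_kern_le[OF this] have "(2::nat) ^ (2 * kdim p) \<le> 2 ^ (2 * d')"
    by (simp only: kdim(1)[OF assms(1)])
  thus ?thesis by simp
qed

lemma kdim_0: "kdim (0, 0) = s"
  by (rule kdim_eqI) (simp add: kern_def L_def card_field)

text \<open>Otherwise \<open>d = s\<close>, so \<open>s\<close> divides \<open>l\<close>, which is
  impossible for \<open>1 \<le> l < 2 * s\<close> and \<open>l \<noteq> s\<close>.\<close>

lemma d_double_le: "2 * d \<le> s"
proof -
  obtain j where j: "s = d * j" using d_dvd(1) by auto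
  have "j \<noteq> 1"
  proof
    assume "j = 1"
    hence "s dvd l" using j d_dvd(2) by simp
    then obtain i where "l = s * i" by auto
    with l_pos l_neq have "i \<noteq> 0" "i \<noteq> 1" by auto
    hence "s * 2 \<le> s * i" by (intro mult_left_mono) auto
    with \<open>l = s * i\<close> l_less show False by simp
  qed
  moreover have "j \<noteq> 0" using j s_pos by (intro notI) simp
  ultimately have "d * 2 \<le> d * j" by (intro mult_left_mono) auto
  thus ?thesis using j by simp
qed

lemma d_triple_le:
  assumes "d' = 2 * d"
  shows "3 * d \<le> s"
proof -
  have s: "s = d * (s div d)" using d_dvd(1) by simp
  have "d * 2 \<le> d * (s div d)" using d_double_le s by simp
  hence "2 \<le> s div d" using d_pos by (simp only: mult_le_cancel1)
  moreover have "s div d \<noteq> 2" using quotients_odd(1)[OF assms] by auto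
  ultimately have "d * 3 \<le> d * (s div d)" by (intro mult_left_mono) auto
  thus ?thesis using s by simp
qed

text \<open>From \<open>d dvd d'\<close> and \<open>d' dvd 2 * d\<close> only \<open>d\<close> and
  \<open>2 * d\<close> are possible. The bound separates the zero pair, with \<open>kdim\<close>
  equal to \<open>s\<close>, from all others.\<close>

lemma d'_less: "d' < s"
proof -
  have "d' dvd 2 * l" by (simp add: d'_def)
  hence "d' dvd gcd (2 * s) (2 * l)" using d'_dvd(1) by (rule gcd_greatest[rotated])
  hence dvd: "d' dvd 2 * d" by (simp only: d_def gcd_mult_distrib_nat)
  have "d dvd s + l" "d dvd 2 * l" using d_dvd by (auto intro: dvd_add)
  hence "d dvd d'" unfolding d'_def by (rule gcd_greatest)
  then obtain e where e: "d' = d * e" by (rule dvdE)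
  hence "e dvd 2" using dvd d_pos by (simp only: mult.commute[of 2] dvd_times_left_cancel_iff)
  hence "e \<le> 2" "e \<noteq> 0" by (auto dest: dvd_imp_le intro!: Nat.gr0I)
  hence "e = 1 \<or> e = 2" by auto
  thus ?thesis
  proof
    assume "e = 1"
    thus ?thesis using e d_double_le d_pos by simp
  next
    assume "e = 2"
    hence d': "d' = 2 * d" using e by simp
    show ?thesis using d_triple_le[OF d'] d' d_pos by linarith
  qed
qed

definition M :: "nat \<Rightarrow> nat" where
  "M k = card {p \<in> P. kdim p = k}"

text \<open>\<open>K\<close> may exceed the set of values of \<open>kdim\<close>, so an explicit
  list of candidates can be inserted.\<close>

lemma sum_kdim:
  assumes "finite K" "kdim ` P \<subseteq> K"
  shows "(\<Sum>p\<in>P. f (kdim p)) = (\<Sum>k\<in>K. of_nat (M k) * (f k :: 'b::comm_semiring_1))"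
proof -
  have "(\<Sum>p\<in>P. f (kdim p)) = (\<Sum>k\<in>K. \<Sum>p | p \<in> P \<and> kdim p = k. f (kdim p))"
    by (rule sum.group[symmetric]) (use assms in auto)
  also have "\<dots> = (\<Sum>k\<in>K. of_nat (M k) * f k)"
    by (rule sum.cong) (simp_all add: M_def)
  finally show ?thesis .
qed

lemma M_s: "M s = 1"
proof -
  have "{p \<in> P. kdim p = s} = {(0, 0)}"
  proof (intro equalityI subsetI)
    fix p assume p: "p \<in> {p \<in> P. kdim p = s}"
    have "p = (0, 0)"
    proof (rule ccontr)
      assume "p \<noteq> (0, 0)"
      with p have "kdim p \<le> d'" by (intro kdim_le) blast+
      thus False using p d'_less by simp
    qed
    thus "p \<in> {(0, 0)}" by simp
  qed (simp add: kdim_0 gf_sub_frob)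
  thus ?thesis by (simp add: M_def)
qed

text \<open>The sum of the signs of all coordinates of a codeword, in which the constant
  \<open>h\<close> acts as a global sign; \<open>T_eq\<close> relates it to the weight.\<close>

definition T :: "('a \<times> 'a) \<times> ('a \<times> bit) \<Rightarrow> int" where
  "T p = bit_sign (snd (snd p)) * S (fst (fst p)) (snd (fst p)) (fst (snd p))"

text \<open>The number of \<open>(c, h)\<close> with sum \<open>v\<close> for a fixed pair
  \<open>(a, b)\<close>. Exactly \<open>2^(2*s - 2*k)\<close> of the \<open>c\<close> give a nonzero
  \<open>S\<close>, with absolute value \<open>2^(s + k)\<close>, and one \<open>h\<close> fits the
  sign of \<open>v\<close>; for the remaining \<open>c\<close> both \<open>h\<close> give
  \<open>0\<close>.\<close>

definition T_count :: "nat \<Rightarrow> int \<Rightarrow> nat" where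
  "T_count k v = (if v = 0 then 2 * (2 ^ (2 * s) - 2 ^ (2 * s - 2 * k))
    else if \<bar>v\<bar> = 2 ^ (s + k) then 2 ^ (2 * s - 2 * k) else 0)"

lemma card_T_eq:
  assumes p: "p \<in> P"
  shows "card {q. T (p, q) = v} = T_count (kdim p) v"
proof -
  define k where "k = kdim p"
  define f where "f = S (fst p) (snd p)"
  have a: "fst p \<in> gf_sub s" using p by auto
  have k: "card (kern (fst p) (snd p)) = 2 ^ (2 * k)" "k \<le> s" using kdim[OF p] by (simp_all add: k_def)
  have T: "T (p, (c, h)) = bit_sign h * f c" for c h by (simp add: T_def f_def)
  have "(f c)\<^sup>2 \<in> {0, (2 ^ (s + k))\<^sup>2}" for c
  proof -
    have "(2 ^ (s + k))\<^sup>2 = (2::int) ^ ((s + k) * 2)" by (simp only: power_mult)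
    also have "(s + k) * 2 = 2 * s + 2 * k" by simp
    also have "(2::int) ^ (2 * s + 2 * k) = 2 ^ (2 * s) * 2 ^ (2 * k)" by (rule power_add)
    finally show ?thesis using S_square[OF a, of "snd p" c] by (simp add: k(1) f_def)
  qed
  hence f: "f c \<in> {0, 2 ^ (s + k), - (2 ^ (s + k))}" for c
    by (force simp: power2_eq_iff)
  have "card {c. f c \<noteq> 0} * 2 ^ (2 * k) = 2 ^ (2 * s - 2 * k) * 2 ^ (2 * k)"
    using card_S_nonzero[OF a, of "snd p"] k by (simp add: f_def flip: power_add)
  hence nz: "card {c. f c \<noteq> 0} = 2 ^ (2 * s - 2 * k)" by simp
  consider "v = 0" | "v \<noteq> 0" "\<bar>v\<bar> = 2 ^ (s + k)" | "v \<noteq> 0" "\<bar>v\<bar> \<noteq> 2 ^ (s + k)" by blast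
  hence "card {q. T (p, q) = v} = T_count k v"
  proof cases
    case 1
    have "{q. T (p, q) = v} = (- {c. f c \<noteq> 0}) \<times> UNIV"
      using 1 by (auto simp: T bit_sign_def split: if_splits)
    moreover have "card (- {c. f c \<noteq> 0}) = 2 ^ (2 * s) - 2 ^ (2 * s - 2 * k)"
      by (simp only: Compl_eq_Diff_UNIV card_Diff_subset finite subset_UNIV nz card_field)
    moreover have "CARD(bit) = 2" by (simp add: UNIV_bit)
    ultimately show ?thesis using 1 by (simp add: T_count_def card_cartesian_product)
  next
    case 2
    have "bij_betw fst {q. T (p, q) = v} {c. f c \<noteq> 0}"
    proof (rule bij_betw_byWitness[where f' = "\<lambda>c. (c, if f c = v then 0 else 1)"])
      show "\<forall>q\<in>{q. T (p, q) = v}. (fst q, if f (fst q) = v then 0 else 1) = q"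
        using 2 by (auto simp: T bit_sign_def split: if_splits)
      show "(\<lambda>c. (c, if f c = v then 0 else 1)) ` {c. f c \<noteq> 0} \<subseteq> {q. T (p, q) = v}"
      proof (rule image_subsetI)
        fix c assume "c \<in> {c. f c \<noteq> 0}"
        hence "f c = v \<or> f c = - v" using f[of c] 2 by (auto simp: abs_if split: if_splits)
        thus "(c, if f c = v then 0 else 1) \<in> {q. T (p, q) = v}" by (auto simp: T)
      qed
    qed (use 2 in \<open>auto simp: T\<close>)
    from bij_betw_same_card[OF this] show ?thesis using 2 by (simp add: nz T_count_def)
  next
    case 3
    have "{q. T (p, q) = v} = {}"
    proof (intro equals0I)
      fix q assume "q \<in> {q. T (p, q) = v}"
      hence "v = bit_sign (snd q) * f (fst q)" using T[of "fst q" "snd q"] by simp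
      with 3 f[of "fst q"] show False by (auto simp: bit_sign_def split: if_splits)
    qed
    thus ?thesis using 3 by (simp add: T_count_def)
  qed
  thus ?thesis by (simp add: k_def)
qed

abbreviation Params :: "(('a \<times> 'a) \<times> ('a \<times> bit)) set" where
  "Params \<equiv> P \<times> UNIV"

lemma card_Params_T:
  assumes "finite K" "kdim ` P \<subseteq> K"
  shows "card {p \<in> Params. T p = v} = (\<Sum>k\<in>K. M k * T_count k v)"
proof -
  have "{p \<in> Params. T p = v} = (SIGMA p:P. {q. T (p, q) = v})" by auto
  hence "card {p \<in> Params. T p = v} = (\<Sum>p\<in>P. card {q. T (p, q) = v})"
    by (simp add: card_SigmaI)
  also have "\<dots> = (\<Sum>p\<in>P. T_count (kdim p) v)"
    by (rule sum.cong) (simp_all only: card_T_eq)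
  also have "\<dots> = (\<Sum>k\<in>K. M k * T_count k v)"
    using sum_kdim[OF assms, of "\<lambda>k. T_count k v"] by simp
  finally show ?thesis .
qed

definition word :: "('a \<times> 'a) \<times> ('a \<times> bit) \<Rightarrow> (bit, 'a) vec" where
  "word p = (\<chi> x. Q (fst (fst p)) (snd (fst p)) x + trace (fst (snd p) * x) + snd (snd p))"

lemma trace_code_eq: "trace_code s l = word ` Params"
proof -
  have pow: "x ^ (2 ^ k + 1) = x * frob k x" for x :: 'a and k by (simp add: frob_def)
  have "abs_trace s (a * x ^ (2 ^ s + 1)) + trace (b * x ^ (2 ^ l + 1) + c * x) + h =
      Q a b x + trace (c * x) + h" for a b c x :: 'a and h
    unfolding pow Q_def abs_trace_m_add by (simp only: add.assoc)
  hence "trace_code s l = {word ((a, b), (c, h)) | a b c h. a \<in> gf_sub s}"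
    by (simp only: trace_code_def word_def fst_conv snd_conv)
  thus ?thesis by force
qed

lemma T_eq: "T p = 2 ^ (2 * s) - 2 * int (hamming_weight (word p))"
proof -
  have "T p = (\<Sum>x\<in>UNIV. bit_sign (word p $ x))"
    by (simp only: T_def S_def word_def vec_lambda_beta bit_sign_add sum_distrib_left mult.commute)
  thus ?thesis by (simp add: sum_bit_sign_eq_hamming_weight card_field)
qed

lemma Params_closed: "p \<in> Params \<Longrightarrow> q \<in> Params \<Longrightarrow> p + q \<in> Params"
  using gf_sub_closed(3)[OF char_2] by (auto simp: plus_prod_def)

lemma word_add:
  assumes "p \<in> Params" "q \<in> Params"
  shows "word (p + q) = word p + word q"
proof -
  have Q_add_param: "Q (a + a') (b + b') x = Q a b x + Q a' b' x" if "a \<in> gf_sub s" "a' \<in> gf_sub s" for a a' b b' x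
  proof -
    have "a * (x * frob s x) \<in> gf_sub s" "a' * (x * frob s x) \<in> gf_sub s"
      using that by (simp_all only: gf_sub_closed(4)[OF char_2 _ norm_in])
    thus ?thesis unfolding Q_def distrib_right
      by (simp only: abs_trace_s_add abs_trace_m_add add.assoc add.left_commute)
  qed
  have a: "fst (fst p) \<in> gf_sub s" "fst (fst q) \<in> gf_sub s" using assms by auto
  show ?thesis
  proof (rule vec_eq_iff[THEN iffD2], rule allI)
    fix x
    show "word (p + q) $ x = (word p + word q) $ x"
      unfolding word_def vec_lambda_beta vector_add_component fst_add snd_add Q_add_param[OF a]
        distrib_right abs_trace_m_add
      by (simp only: add.assoc add.left_commute)
  qed
qed

lemma word_0: "word 0 = 0"
  by (simp add: vec_eq_iff word_def Q_def)

lemma zero_in_Params: "0 \<in> Params"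
  by (simp add: zero_prod_def gf_sub_frob)

lemma hamming_weight_0: "hamming_weight (0 :: (bit, 'a) vec) = 0"
  by (simp add: hamming_weight_def)

lemma subspace_trace_code: "vec.subspace (trace_code s l :: (bit, 'a) vec set)"
proof (rule vec.subspaceI)
  show zero: "0 \<in> (trace_code s l :: (bit, 'a) vec set)"
    unfolding trace_code_eq by (rule image_eqI[where x = 0, OF _ zero_in_Params]) (rule word_0[symmetric])
  show "x + y \<in> trace_code s l" if xy: "x \<in> trace_code s l" "y \<in> trace_code s l" for x y :: "(bit, 'a) vec"
  proof -
    obtain p where p: "x = word p" "p \<in> Params"
      using xy(1) unfolding trace_code_eq by (rule imageE)
    obtain q where q: "y = word q" "q \<in> Params"
      using xy(2) unfolding trace_code_eq by (rule imageE)
    have "x + y = word (p + q)" unfolding p(1) q(1) by (rule word_add[OF p(2) q(2), symmetric])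
    thus ?thesis unfolding trace_code_eq using Params_closed[OF p(2) q(2)] by (rule image_eqI)
  qed
  show "k *s x \<in> trace_code s l" if "x \<in> trace_code s l" for k and x :: "(bit, 'a) vec"
    using that zero by (cases k) simp_all
qed

lemma card_Params_T_nonzero:
  assumes "\<bar>v\<bar> = 2 ^ (s + k)"
  shows "card {p \<in> Params. T p = v} = M k * 2 ^ (2 * s - 2 * k)"
proof -
  \<comment> \<open>Inserting \<open>k\<close> covers a value that does not occur, where
    \<open>M k = 0\<close>.\<close>
  let ?K = "insert k (kdim ` P)"
  have "v \<noteq> 0" using assms by auto
  have "card {p \<in> Params. T p = v} = (\<Sum>i\<in>?K. M i * T_count i v)"
    by (rule card_Params_T) auto
  also have "\<dots> = (\<Sum>i\<in>?K. if i = k then M k * 2 ^ (2 * s - 2 * k) else 0)"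
    by (rule sum.cong) (use \<open>v \<noteq> 0\<close> assms in \<open>auto simp: T_count_def\<close>)
  finally show ?thesis by simp
qed

text \<open>Parameters with the same word add up to one with the zero word, hence with
  \<open>T\<close> equal to \<open>2^(2*s)\<close>. Since \<open>M s = 1\<close>, only the zero
  parameter attains that value.\<close>

lemma inj_word: "inj_on word Params"
proof (rule inj_onI)
  fix p q assume pq: "p \<in> Params" "q \<in> Params" "word p = word q"
  have "card {p \<in> Params. T p = 2 ^ (2 * s)} = M s * 2 ^ (2 * s - 2 * s)"
    by (rule card_Params_T_nonzero) (simp add: mult_2)
  hence "card {p \<in> Params. T p = 2 ^ (2 * s)} = 1" by (simp add: M_s)
  then obtain r where r: "{p \<in> Params. T p = 2 ^ (2 * s)} = {r}" by (rule card_1_singletonE)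
  have "word (p + q) = word p + word p" using pq word_add by metis
  also have "\<dots> = 0" by (simp add: vec_eq_iff)
  finally have "p + q \<in> {p \<in> Params. T p = 2 ^ (2 * s)}"
    using Params_closed[OF pq(1,2)] by (simp add: T_eq hamming_weight_0)
  moreover have "0 \<in> {p \<in> Params. T p = 2 ^ (2 * s)}"
    by (simp only: mem_Collect_eq T_eq word_0 hamming_weight_0 zero_in_Params) simp
  ultimately have 0: "p + q = 0" unfolding r by simp
  have "x + x = 0" for x :: bit by (cases x) simp_all
  hence "p + p = 0" by (simp add: prod_eq_iff)
  with 0 show "p = q" by (metis add_left_cancel)
qed

lemma weight_count_eq:
  "weight_count (trace_code s l :: (bit, 'a) vec set) w = card {p \<in> Params. T p = 2 ^ (2 * s) - 2 * int w}"
proof -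
  have "{v \<in> trace_code s l. hamming_weight v = w} = word ` {p \<in> Params. T p = 2 ^ (2 * s) - 2 * int w}"
    unfolding trace_code_eq T_eq by auto
  moreover have "inj_on word {p \<in> Params. T p = 2 ^ (2 * s) - 2 * int w}"
    by (rule inj_on_subset[OF inj_word]) auto
  ultimately show ?thesis by (simp add: weight_count_def card_image)
qed

lemma dim_trace_code: "vec.dim (trace_code s l :: (bit, 'a) vec set) = 5 * s + 1"
proof -
  have "(2::nat) ^ vec.dim (trace_code s l :: (bit, 'a) vec set) = card (trace_code s l :: (bit, 'a) vec set)"
    by (rule card_subspace_bit[OF subspace_trace_code, symmetric])
  also have "\<dots> = card Params"
    unfolding trace_code_eq by (rule card_image[OF inj_word])
  also have "\<dots> = 2 ^ (3 * s) * (2 ^ (2 * s) * 2)"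
  proof -
    have "CARD('a \<times> bit) = 2 ^ (2 * s) * 2" by (simp add: card_field UNIV_bit)
    thus ?thesis by (simp only: card_cartesian_product[of P] card_P)
  qed
  also have "\<dots> = 2 ^ (3 * s + 2 * s + 1)" by (simp only: power_add power_one_right mult.assoc)
  also have "3 * s + 2 * s + 1 = 5 * s + 1" by simp
  finally show ?thesis by (rule power_inject_exp[THEN iffD1, rotated]) simp
qed

lemma weight_count_minus:
  assumes "k \<le> s"
  shows "weight_count (trace_code s l :: (bit, 'a) vec set) (2 ^ (2 * s - 1) - 2 ^ (s + k - 1)) = M k * 2 ^ (2 * s - 2 * k)"
proof -
  \<comment> \<open>For \<open>k \<le> s\<close> the subtraction in the weight is not
    truncated.\<close>
  have le: "(2::nat) ^ (s + k - 1) \<le> 2 ^ (2 * s - 1)" using assms by (intro power_increasing) auto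
  have "2 * (2::int) ^ (2 * s - 1) = 2 ^ (2 * s)" "2 * (2::int) ^ (s + k - 1) = 2 ^ (s + k)"
    using s_pos by (simp_all flip: power_Suc)
  hence "2 ^ (2 * s) - 2 * int (2 ^ (2 * s - 1) - 2 ^ (s + k - 1)) = 2 ^ (s + k)"
    using le by (simp add: of_nat_diff)
  thus ?thesis unfolding weight_count_eq by (simp only: card_Params_T_nonzero abs_power2 abs_numeral power_abs)
qed

lemma weight_count_plus:
  shows "weight_count (trace_code s l :: (bit, 'a) vec set) (2 ^ (2 * s - 1) + 2 ^ (s + k - 1)) = M k * 2 ^ (2 * s - 2 * k)"
proof -
  have "2 * (2::int) ^ (2 * s - 1) = 2 ^ (2 * s)" "2 * (2::int) ^ (s + k - 1) = 2 ^ (s + k)"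
    using s_pos by (simp_all flip: power_Suc)
  hence "2 ^ (2 * s) - 2 * int (2 ^ (2 * s - 1) + 2 ^ (s + k - 1)) = - (2 ^ (s + k))" by simp
  thus ?thesis unfolding weight_count_eq
    by (simp only: card_Params_T_nonzero abs_minus_cancel abs_numeral power_abs)
qed

lemma weight_count_half:
  assumes K: "finite K" "kdim ` P \<subseteq> K"
  shows "weight_count (trace_code s l :: (bit, 'a) vec set) (2 ^ (2 * s - 1)) =
    (\<Sum>k\<in>K. M k * (2 * (2 ^ (2 * s) - 2 ^ (2 * s - 2 * k))))"
proof -
  have "2 * (2::int) ^ (2 * s - 1) = 2 ^ (2 * s)"
    using s_pos by (simp_all flip: power_Suc)
  thus ?thesis by (simp add: weight_count_eq card_Params_T[OF K] T_count_def)
qed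

lemma weight_count_eq_0:
  assumes K: "finite K" "kdim ` P \<subseteq> K"
    and half_weight: "w \<noteq> 2 ^ (2 * s - 1)"
    and weight: "\<And>k. k \<in> K \<Longrightarrow> w \<noteq> 2 ^ (2 * s - 1) - 2 ^ (s + k - 1) \<and> w \<noteq> 2 ^ (2 * s - 1) + 2 ^ (s + k - 1)"
  shows "weight_count (trace_code s l :: (bit, 'a) vec set) w = 0"
proof -
  define v where "v = (2::int) ^ (2 * s) - 2 * int w"
  define X where "X = (2::nat) ^ (2 * s - 1)"
  have half: "2 ^ (2 * s) = 2 * int X"
    using s_pos by (simp add: X_def flip: power_Suc)
  have "T_count k v = 0" if k: "k \<in> K" for k
  proof -
    define Y where "Y = (2::nat) ^ (s + k - 1)"
    have half_k: "2 ^ (s + k) = 2 * int Y"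
      using s_pos by (simp add: Y_def flip: power_Suc)
    have w: "w \<noteq> X" "w \<noteq> X - Y" "w \<noteq> X + Y"
      using half_weight weight[OF k] by (simp_all add: X_def Y_def)
    have "v \<noteq> 0" using w(1) by (simp add: v_def half)
    moreover have "\<bar>v\<bar> \<noteq> 2 ^ (s + k)" using w(2,3) unfolding v_def half half_k by linarith
    ultimately show ?thesis by (simp add: T_count_def)
  qed
  thus ?thesis unfolding weight_count_eq card_Params_T[OF K] by (simp add: v_def)
qed

end

section \<open>The multiplicities\<close>

text \<open>Here \<open>P = 2^s\<close> and \<open>D = 2^d\<close>, and the summands \<open>1\<close>, \<open>P\<^sup>2\<close> outside the unknowns come
  from the pair \<open>(0, 0)\<close>.\<close>
lemma two_kernel_sizes_solution:
  fixes P D x y :: real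
  assumes D: "D > 1"
    and count: "x + y + 1 = P ^ 3"
    and kernels: "x + D\<^sup>2 * y + P\<^sup>2 = P ^ 3 + (P\<^sup>2 - 1) * (P * D)"
  shows "x = (P - 1) * (P\<^sup>2 * D\<^sup>2 - P\<^sup>2 * D - P\<^sup>2 + P * D\<^sup>2 - P * D + D\<^sup>2) / (D\<^sup>2 - 1)"
    and "y = (P * D - 1) * (P\<^sup>2 - 1) / (D\<^sup>2 - 1)"
    and "y * (2 * (P\<^sup>2 - P\<^sup>2 / D\<^sup>2)) + 2 * (P\<^sup>2 - 1) = 2 * (P ^ 3 / D - P\<^sup>2 / D\<^sup>2 + 1) * (P\<^sup>2 - 1)"
proof -
  have "D\<^sup>2 > 1" using D by (rule one_less_power) simp
  hence nz: "D\<^sup>2 - 1 \<noteq> 0" by simp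
  \<comment> \<open>Subtracting \<open>count\<close> from \<open>kernels\<close> eliminates
    \<open>x\<close>.\<close>
  have y: "y * (D\<^sup>2 - 1) = (P * D - 1) * (P\<^sup>2 - 1)" using count kernels by algebra
  thus "y = (P * D - 1) * (P\<^sup>2 - 1) / (D\<^sup>2 - 1)" using nz by (simp add: nonzero_eq_divide_eq)
  have "x * (D\<^sup>2 - 1) = (P - 1) * (P\<^sup>2 * D\<^sup>2 - P\<^sup>2 * D - P\<^sup>2 + P * D\<^sup>2 - P * D + D\<^sup>2)"
    using count kernels by algebra
  thus "x = (P - 1) * (P\<^sup>2 * D\<^sup>2 - P\<^sup>2 * D - P\<^sup>2 + P * D\<^sup>2 - P * D + D\<^sup>2) / (D\<^sup>2 - 1)"
    using nz by (simp add: nonzero_eq_divide_eq)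
  have "y * (P\<^sup>2 - P\<^sup>2 / D\<^sup>2) = y * (D\<^sup>2 - 1) * (P\<^sup>2 / D\<^sup>2)" using D by (simp add: field_simps)
  also have "\<dots> = (P ^ 3 / D - P\<^sup>2 / D\<^sup>2) * (P\<^sup>2 - 1)"
    unfolding y using D by (simp add: field_simps power2_eq_square power3_eq_cube)
  finally have "2 * (y * (P\<^sup>2 - P\<^sup>2 / D\<^sup>2)) + 2 * (P\<^sup>2 - 1) =
      2 * ((P ^ 3 / D - P\<^sup>2 / D\<^sup>2) * (P\<^sup>2 - 1)) + 2 * (P\<^sup>2 - 1)" by (rule arg_cong)
  also have "2 * (t * (P\<^sup>2 - 1)) + 2 * (P\<^sup>2 - 1) = 2 * (t + 1) * (P\<^sup>2 - 1)" for t
    by (simp add: algebra_simps)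
  finally show "y * (2 * (P\<^sup>2 - P\<^sup>2 / D\<^sup>2)) + 2 * (P\<^sup>2 - 1) = 2 * (P ^ 3 / D - P\<^sup>2 / D\<^sup>2 + 1) * (P\<^sup>2 - 1)"
    by (simp only: mult.left_commute)
qed

text \<open>\<open>x\<close>, \<open>y\<close>, \<open>z\<close> are the multiplicities of
  \<open>0\<close>, \<open>d\<close>, \<open>2 * d\<close>. In \<open>signs\<close> the exponential
  sums are \<open>-P\<close>, \<open>P * D\<close>, \<open>-P * D^2\<close> for these classes and
  \<open>P^2\<close> for the zero pair.\<close>

lemma three_kernel_sizes_solution:
  fixes P D x y z :: real
  assumes D: "D > 1"
    and count: "x + y + z + 1 = P ^ 3"
    and kernels: "x + D\<^sup>2 * y + D ^ 4 * z + P\<^sup>2 = P ^ 3 + (P\<^sup>2 - 1) * (P * D)"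
    and signs: "P\<^sup>2 - P * x + P * D * y - P * D\<^sup>2 * z = P ^ 3"
    and P: "P > 0"
  shows "P\<^sup>2 * x = P\<^sup>2 * D ^ 3 * (P - 1) * (P\<^sup>2 - P\<^sup>2 / D\<^sup>2 - P\<^sup>2 / D ^ 3 + P - P / D + 1) / ((D\<^sup>2 - 1) * (D + 1))"
    and "P\<^sup>2 / D\<^sup>2 * y = P\<^sup>2 / D * (P\<^sup>2 - 1) * (P + P / D + P / D\<^sup>2 + 1) / (D + 1)\<^sup>2"
    and "P\<^sup>2 / D ^ 4 * z = P\<^sup>2 / D ^ 4 * (P / D - 1) * (P\<^sup>2 - 1) / ((D + 1) * (D\<^sup>2 - 1))"
    and "y * (2 * (P\<^sup>2 - P\<^sup>2 / D\<^sup>2)) + z * (2 * (P\<^sup>2 - P\<^sup>2 / D ^ 4)) + 2 * (P\<^sup>2 - 1) =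
      2 * (P\<^sup>2 - 1) * (P ^ 3 / D - P ^ 3 / D\<^sup>2 + P ^ 3 / D ^ 3 - P ^ 3 / D ^ 4 + P ^ 3 / D ^ 5
        + P\<^sup>2 / D - 2 * P\<^sup>2 / D\<^sup>2 + P\<^sup>2 / D ^ 3 - P\<^sup>2 / D ^ 4 + 1)"
proof -
  have "D\<^sup>2 > 1" using D by (rule one_less_power) simp
  hence nz: "D\<^sup>2 - 1 \<noteq> 0" "D + 1 \<noteq> 0" "D \<noteq> 0" using D by linarith+
  have signs': "x - D * y + D\<^sup>2 * z = P - P\<^sup>2"
  proof -
    have "P * (x - D * y + D\<^sup>2 * z) = P * (P - P\<^sup>2)" using signs by (simp add: power2_eq_square power3_eq_cube algebra_simps)
    thus ?thesis using P by simp
  qed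
  define E where "E = (D\<^sup>2 - 1) * (D + 1)"
  have E: "E \<noteq> 0" using nz by (simp add: E_def)
  have z1: "(D * E) * z = (P - D) * (P\<^sup>2 - 1)"
    unfolding E_def using count kernels signs' by algebra
  have y1: "(D + 1)\<^sup>2 * (D * y) = (P\<^sup>2 - 1) * (P * D\<^sup>2 + P * D + P + D\<^sup>2)"
  proof -
    \<comment> \<open>The extra factor makes this a polynomial consequence of the three equations;
      it is cancelled afterwards.\<close>
    have "(D\<^sup>2 - 1) * ((D + 1)\<^sup>2 * (D * y)) = (D\<^sup>2 - 1) * ((P\<^sup>2 - 1) * (P * D\<^sup>2 + P * D + P + D\<^sup>2))"
      using count kernels signs' by algebra
    thus ?thesis using nz by simp
  qed
  have x1: "E * x = (P - 1) * (P\<^sup>2 * D ^ 3 - P\<^sup>2 * D - P\<^sup>2 + P * D ^ 3 - P * D\<^sup>2 + D ^ 3)"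
    using count kernels signs' z1 y1 unfolding E_def by algebra
  have z: "z = (P - D) * (P\<^sup>2 - 1) / (D * E)"
    using z1 E nz by (simp add: nonzero_eq_divide_eq mult.commute)
  have y: "y = (P\<^sup>2 - 1) * (P * D\<^sup>2 + P * D + P + D\<^sup>2) / ((D + 1)\<^sup>2 * D)"
    using y1 nz by (simp add: nonzero_eq_divide_eq mult_ac)
  have x: "x = (P - 1) * (P\<^sup>2 * D ^ 3 - P\<^sup>2 * D - P\<^sup>2 + P * D ^ 3 - P * D\<^sup>2 + D ^ 3) / E"
    using x1 E by (simp add: nonzero_eq_divide_eq mult.commute)
  have "D ^ 3 * (P\<^sup>2 - P\<^sup>2 / D\<^sup>2 - P\<^sup>2 / D ^ 3 + P - P / D + 1) =
      P\<^sup>2 * D ^ 3 - P\<^sup>2 * D - P\<^sup>2 + P * D ^ 3 - P * D\<^sup>2 + D ^ 3"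
    using nz by (simp add: field_simps power2_eq_square power3_eq_cube)
  thus "P\<^sup>2 * x = P\<^sup>2 * D ^ 3 * (P - 1) * (P\<^sup>2 - P\<^sup>2 / D\<^sup>2 - P\<^sup>2 / D ^ 3 + P - P / D + 1) / ((D\<^sup>2 - 1) * (D + 1))"
    unfolding x E_def by (simp add: mult_ac)
  have "D * (P + P / D + P / D\<^sup>2 + 1) = (P * D\<^sup>2 + P * D + P + D\<^sup>2) / D"
    using nz by (simp add: field_simps power2_eq_square)
  thus "P\<^sup>2 / D\<^sup>2 * y = P\<^sup>2 / D * (P\<^sup>2 - 1) * (P + P / D + P / D\<^sup>2 + 1) / (D + 1)\<^sup>2"
    unfolding y using nz(3) by (simp add: field_simps power2_eq_square)
  have "P / D - 1 = (P - D) / D" using nz by (simp add: field_simps)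
  thus "P\<^sup>2 / D ^ 4 * z = P\<^sup>2 / D ^ 4 * (P / D - 1) * (P\<^sup>2 - 1) / ((D + 1) * (D\<^sup>2 - 1))"
    unfolding z E_def by (simp add: mult_ac)
  \<comment> \<open>The bracket of the claim without its final \<open>1\<close>, times
    \<open>D^5 / P^2\<close>. That \<open>1\<close> is the share of the zero pair.\<close>
  define R where "R = P * D ^ 4 - P * D ^ 3 + P * D\<^sup>2 - P * D + P + D ^ 4 - 2 * D ^ 3 + D\<^sup>2 - D"
  have "(D + 1) * (D * (y * (D\<^sup>2 * (D\<^sup>2 - 1)) + z * (D ^ 4 - 1))) = (D + 1) * ((P\<^sup>2 - 1) * R)"
    using y1 z1 unfolding R_def E_def by algebra
  hence key: "D * (y * (D\<^sup>2 * (D\<^sup>2 - 1)) + z * (D ^ 4 - 1)) = (P\<^sup>2 - 1) * R"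
    using nz by simp
  have "y * (P\<^sup>2 - P\<^sup>2 / D\<^sup>2) + z * (P\<^sup>2 - P\<^sup>2 / D ^ 4) =
      P\<^sup>2 / D ^ 5 * (D * (y * (D\<^sup>2 * (D\<^sup>2 - 1)) + z * (D ^ 4 - 1)))"
    using nz(3) by (simp add: field_simps eval_nat_numeral)
  also have "\<dots> = (P\<^sup>2 - 1) * (P\<^sup>2 / D ^ 5 * R)" by (simp only: key mult_ac)
  also have "P\<^sup>2 / D ^ 5 * R = P ^ 3 / D - P ^ 3 / D\<^sup>2 + P ^ 3 / D ^ 3 - P ^ 3 / D ^ 4 + P ^ 3 / D ^ 5
        + P\<^sup>2 / D - 2 * P\<^sup>2 / D\<^sup>2 + P\<^sup>2 / D ^ 3 - P\<^sup>2 / D ^ 4" (is "_ = ?F")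
    using nz(3) by (simp add: R_def field_simps eval_nat_numeral)
  finally have "2 * (y * (P\<^sup>2 - P\<^sup>2 / D\<^sup>2) + z * (P\<^sup>2 - P\<^sup>2 / D ^ 4)) + 2 * (P\<^sup>2 - 1) =
      2 * ((P\<^sup>2 - 1) * ?F) + 2 * (P\<^sup>2 - 1)" by (rule arg_cong)
  also have "2 * ((P\<^sup>2 - 1) * t) + 2 * (P\<^sup>2 - 1) = 2 * (P\<^sup>2 - 1) * (t + 1)" for t
    by (simp add: algebra_simps)
  finally show "y * (2 * (P\<^sup>2 - P\<^sup>2 / D\<^sup>2)) + z * (2 * (P\<^sup>2 - P\<^sup>2 / D ^ 4)) + 2 * (P\<^sup>2 - 1) =
      2 * (P\<^sup>2 - 1) * (P ^ 3 / D - P ^ 3 / D\<^sup>2 + P ^ 3 / D ^ 3 - P ^ 3 / D ^ 4 + P ^ 3 / D ^ 5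
        + P\<^sup>2 / D - 2 * P\<^sup>2 / D\<^sup>2 + P\<^sup>2 / D ^ 3 - P\<^sup>2 / D ^ 4 + 1)"
    by (simp only: distrib_left mult.left_commute)
qed

lemma two_power_diff: "n \<le> k \<Longrightarrow> (2::real) ^ (k - n) = 2 ^ k / 2 ^ n"
  by (simp add: power_diff)

lemma two_power_mult: "(2::real) ^ (n * k) = (2 ^ k) ^ n"
  by (simp only: power_mult[symmetric] mult.commute)

section \<open>Linear equations for the multiplicities\<close>

context trace_form
begin

lemma kdim_multiple:
  assumes "p \<in> P" "p \<noteq> (0, 0)"
  obtains i where "kdim p = d * i" "d * i \<le> d'"
  using kdim(2)[OF assms(1)] kdim_le[OF assms] by (metis dvdE)

lemma sum_M:
  assumes "finite K" "kdim ` P \<subseteq> K"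
  shows "(\<Sum>k\<in>K. real (M k)) = (2 ^ s) ^ 3"
    and "(\<Sum>k\<in>K. real (M k) * (2 ^ k)\<^sup>2) = (2 ^ s) ^ 3 + ((2 ^ s)\<^sup>2 - 1) * (2 ^ s * 2 ^ d)"
proof -
  have "(\<Sum>k\<in>K. real (M k)) = real (card P)"
    using sum_kdim[OF assms, of "\<lambda>_. 1 :: real"] by (simp only: mult_1_right sum_constant)
  thus "(\<Sum>k\<in>K. real (M k)) = (2 ^ s) ^ 3" by (simp add: card_P two_power_mult)
  have "(\<Sum>k\<in>K. real (M k) * (2 ^ k)\<^sup>2) = (\<Sum>p\<in>P. (2 ^ kdim p)\<^sup>2)"
    using sum_kdim[OF assms, of "\<lambda>k. (2 ^ k)\<^sup>2 :: real"] by (simp only:)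
  also have "\<dots> = real (\<Sum>p\<in>P. card (kern (fst p) (snd p)))"
    unfolding of_nat_sum by (rule sum.cong) (simp_all only: kdim(1) two_power_mult of_nat_power of_nat_numeral)
  also have "\<dots> = (2 ^ s) ^ 3 + ((2 ^ s)\<^sup>2 - 1) * (2 ^ s * 2 ^ d)"
    unfolding sum_card_kern by (simp add: of_nat_diff two_power_mult power_add)
  finally show "(\<Sum>k\<in>K. real (M k) * (2 ^ k)\<^sup>2) = (2 ^ s) ^ 3 + ((2 ^ s)\<^sup>2 - 1) * (2 ^ s * 2 ^ d)" .
qed

text \<open>This is \<open>sum_S\<close> grouped by \<open>kdim\<close>, with each sum evaluated by
  \<open>S_value\<close>; the parity of \<open>k div d\<close> carries the sign.\<close>

lemma sum_M_signed:
  assumes "finite K" "kdim ` P \<subseteq> K" "d' = 2 * d"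
  shows "(\<Sum>k\<in>K. real (M k) * (- ((- 1) ^ (k div d) * 2 ^ (s + k)))) = (2 ^ s) ^ 3"
proof -
  have "(\<Sum>k\<in>K. real (M k) * (- ((- 1) ^ (k div d) * 2 ^ (s + k)))) =
      (\<Sum>p\<in>P. - ((- 1) ^ (kdim p div d) * 2 ^ (s + kdim p)))"
    using sum_kdim[OF assms(1,2), of "\<lambda>k. - ((- 1) ^ (k div d) * 2 ^ (s + k)) :: real"] by (simp only:)
  also have "\<dots> = real_of_int (\<Sum>p\<in>P. S (fst p) (snd p) 0)"
    unfolding of_int_sum
  proof (rule sum.cong[OF refl])
    fix p assume p: "p \<in> P"
    obtain i where i: "kdim p = d * i" using kdim(2)[OF p] by (rule dvdE)
    have a: "fst p \<in> gf_sub s" using p by auto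
    have c: "card (kern (fst p) (snd p)) = 2 ^ (2 * (d * i))" using kdim(1)[OF p] by (simp only: i)
    show "- ((- 1) ^ (kdim p div d) * 2 ^ (s + kdim p)) = real_of_int (S (fst p) (snd p) 0)"
      unfolding S_value[OF assms(3) a c] i using d_pos by simp
  qed
  finally show ?thesis by (simp add: sum_S two_power_mult)
qed

lemma kdim_image_1:
  assumes "d' = d"
  shows "kdim ` P \<subseteq> {0, d, s}"
proof (rule image_subsetI)
  fix p assume p: "p \<in> P"
  show "kdim p \<in> {0, d, s}"
  proof (cases "p = (0, 0)")
    case True
    thus ?thesis by (simp add: kdim_0)
  next
    case False
    obtain i where i: "kdim p = d * i" "d * i \<le> d * 1" using kdim_multiple[OF p False] assms by auto
    hence "i \<le> 1" using d_pos by (simp only: mult_le_cancel1)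
    hence "i = 0 \<or> i = 1" by auto
    thus ?thesis using i by auto
  qed
qed

lemma kdim_image_2:
  assumes "d' = 2 * d"
  shows "kdim ` P \<subseteq> {0, d, 2 * d, s}"
proof (rule image_subsetI)
  fix p assume p: "p \<in> P"
  show "kdim p \<in> {0, d, 2 * d, s}"
  proof (cases "p = (0, 0)")
    case True
    thus ?thesis by (simp add: kdim_0)
  next
    case False
    obtain i where i: "kdim p = d * i" "d * i \<le> d * 2" using kdim_multiple[OF p False] assms by auto
    hence "i \<le> 2" using d_pos by (simp only: mult_le_cancel1)
    hence "i = 0 \<or> i = 1 \<or> i = 2" by auto
    thus ?thesis using i by auto
  qed
qed

end

section \<open>Dimension and weight distribution of the code\<close>

theorem theorem6:
  fixes s m l d d' :: nat and C :: "(bit ^ 'a::finite_field) set"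
  assumes "s \<ge> 2" and "m = 2 * s" and "CARD('a) = 2 ^ m"
    and "1 \<le> l" and "l \<le> m - 1" and "l \<noteq> s"
    and "d = gcd s l" and "d' = gcd (s + l) (2 * l)"
    and "C = trace_code s l"
  shows "vec.subspace C \<and> code_length C = 2 ^ m \<and> vec.dim C = 5 * m div 2 + 1 \<and>
    (d' = d \<longrightarrow>
      weight_count C 0 = 1 \<and>
      (\<forall>w \<in> {2 ^ (2 * s - 1) - 2 ^ (s - 1), 2 ^ (2 * s - 1) + 2 ^ (s - 1)}.
         real (weight_count C w) =
           2 ^ (2 * s) * (2 ^ s - 1) *
           (2 ^ (2 * (s + d)) - 2 ^ (2 * s + d) - 2 ^ (2 * s) + 2 ^ (s + 2 * d) - 2 ^ (s + d) + 2 ^ (2 * d)) /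
           (2 ^ (2 * d) - 1)) \<and>
      (\<forall>w \<in> {2 ^ (2 * s - 1) - 2 ^ (s + d - 1), 2 ^ (2 * s - 1) + 2 ^ (s + d - 1)}.
         real (weight_count C w) =
           2 ^ (2 * (s - d)) * (2 ^ (s + d) - 1) * (2 ^ (2 * s) - 1) / (2 ^ (2 * d) - 1)) \<and>
      real (weight_count C (2 ^ (2 * s - 1))) =
        2 * (2 ^ (3 * s - d) - 2 ^ (2 * (s - d)) + 1) * (2 ^ (2 * s) - 1) \<and>
      weight_count C (2 ^ (2 * s)) = 1 \<and>
      (\<forall>w. w \<notin> {0, 2 ^ (2 * s - 1) - 2 ^ (s - 1), 2 ^ (2 * s - 1) + 2 ^ (s - 1),
                 2 ^ (2 * s - 1) - 2 ^ (s + d - 1), 2 ^ (2 * s - 1) + 2 ^ (s + d - 1),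
                 2 ^ (2 * s - 1), 2 ^ (2 * s)} \<longrightarrow>
         weight_count C w = 0)) \<and>
    (d' = 2 * d \<longrightarrow>
      weight_count C 0 = 1 \<and>
      (\<forall>w \<in> {2 ^ (2 * s - 1) - 2 ^ (s - 1), 2 ^ (2 * s - 1) + 2 ^ (s - 1)}.
         real (weight_count C w) =
           2 ^ (2 * s + 3 * d) * (2 ^ s - 1) *
           (2 ^ (2 * s) - 2 ^ (2 * (s - d)) - 2 ^ (2 * s - 3 * d) + 2 ^ s - 2 ^ (s - d) + 1) /
           ((2 ^ (2 * d) - 1) * (2 ^ d + 1))) \<and>
      (\<forall>w \<in> {2 ^ (2 * s - 1) - 2 ^ (s + d - 1), 2 ^ (2 * s - 1) + 2 ^ (s + d - 1)}.
         real (weight_count C w) =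
           2 ^ (2 * s - d) * (2 ^ (2 * s) - 1) * (2 ^ s + 2 ^ (s - d) + 2 ^ (s - 2 * d) + 1) /
           (2 ^ d + 1) ^ 2) \<and>
      real (weight_count C (2 ^ (2 * s - 1))) =
        2 * (2 ^ (2 * s) - 1) *
        (2 ^ (3 * s - d) - 2 ^ (3 * s - 2 * d) + 2 ^ (3 * s - 3 * d) - 2 ^ (3 * s-4 * d) + 2 ^ (3 * s-5 * d)
         + 2 ^ (2 * s - d) - 2 ^ (2 * s - 2 * d + 1) + 2 ^ (2 * s - 3 * d) - 2 ^ (2 * s-4 * d) + 1) \<and>
      (\<forall>w \<in> {2 ^ (2 * s - 1) - 2 ^ (s + 2 * d - 1), 2 ^ (2 * s - 1) + 2 ^ (s + 2 * d - 1)}.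
         real (weight_count C w) =
           2 ^ (2 * s-4 * d) * (2 ^ (s - d) - 1) * (2 ^ (2 * s) - 1) /
           ((2 ^ d + 1) * (2 ^ (2 * d) - 1))) \<and>
      weight_count C (2 ^ (2 * s)) = 1 \<and>
      (\<forall>w. w \<notin> {0, 2 ^ (2 * s - 1) - 2 ^ (s - 1), 2 ^ (2 * s - 1) + 2 ^ (s - 1),
                 2 ^ (2 * s - 1) - 2 ^ (s + d - 1), 2 ^ (2 * s - 1) + 2 ^ (s + d - 1),
                 2 ^ (2 * s - 1),
                 2 ^ (2 * s - 1) - 2 ^ (s + 2 * d - 1), 2 ^ (2 * s - 1) + 2 ^ (s + 2 * d - 1), 2 ^ (2 * s)} \<longrightarrow>
         weight_count C w = 0))"
proof -
  have card: "CARD('a) = 2 ^ (2 * s)" using assms(2,3) by simp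
  interpret tf: trace_form s "TYPE('a)" l
    by unfold_locales (use card assms in auto)
  have d: "tf.d = d" and d': "tf.d' = d'" using assms by (simp_all add: tf.d_def tf.d'_def)
  note C = \<open>C = trace_code s l\<close>
  define P D :: real where "P = 2 ^ s" and "D = 2 ^ d"
  have d_pos: "0 < d" and d2: "2 * d \<le> s" using tf.d_pos tf.d_double_le by (simp_all only: d)
  hence s_pos: "0 < s" by simp
  have "D > 1" using d_pos by (simp add: D_def one_less_power)
  have "P > 0" by (simp add: P_def)
  have half_weight: "real (weight_count C (2 ^ (2 * s - 1))) =
      (\<Sum>k\<in>K. real (tf.M k) * (2 * (P\<^sup>2 - P\<^sup>2 / (2 ^ k)\<^sup>2)))"
    if K: "finite K" "tf.kdim ` tf.P \<subseteq> K" "K \<subseteq> {..s}" for K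
  proof -
    have "real (2 ^ (2 * s) - 2 ^ (2 * s - 2 * k)) = P\<^sup>2 - P\<^sup>2 / (2 ^ k)\<^sup>2" if "k \<in> K" for k
    proof -
      have "k \<le> s" using K(3) that by auto
      thus ?thesis by (simp add: of_nat_diff two_power_diff two_power_mult P_def)
    qed
    thus ?thesis unfolding C tf.weight_count_half[OF K(1,2)] of_nat_sum
      by (intro sum.cong) (simp_all only: of_nat_mult of_nat_numeral)
  qed
  have weight: "real (weight_count C w) = P\<^sup>2 / (2 ^ k)\<^sup>2 * real (tf.M k)"
    if "k \<le> s" "w \<in> {2 ^ (2 * s - 1) - 2 ^ (s + k - 1), 2 ^ (2 * s - 1) + 2 ^ (s + k - 1)}" for k w
  proof -
    have "weight_count C w = tf.M k * 2 ^ (2 * s - 2 * k)"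
      using that(2) tf.weight_count_minus[OF that(1)] tf.weight_count_plus[of k] unfolding C by blast
    thus ?thesis using that(1)
      by (simp add: two_power_diff two_power_mult P_def)
  qed
  \<comment> \<open>For \<open>k = s\<close> the two weights are \<open>0\<close> and the length, so
    the zero pair supplies the zero word and the all-one word.\<close>
  have s_weights: "(0::nat) = 2 ^ (2 * s - 1) - 2 ^ (s + s - 1)" "(2::nat) ^ (2 * s) = 2 ^ (2 * s - 1) + 2 ^ (s + s - 1)"
  proof -
    have "(2::nat) ^ (2 * s - 1) + 2 ^ (2 * s - 1) = 2 ^ Suc (2 * s - 1)" by simp
    thus "(2::nat) ^ (2 * s) = 2 ^ (2 * s - 1) + 2 ^ (s + s - 1)" using s_pos by (simp add: mult_2)
  qed (simp add: mult_2)
  have ends: "weight_count C 0 = 1" "weight_count C (2 ^ (2 * s)) = 1"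
    using tf.weight_count_minus[of s] tf.weight_count_plus[of s]
    unfolding C s_weights[symmetric] by (simp_all add: tf.M_s)
  have plus: "(2::real) ^ (2 * (s + d)) = P\<^sup>2 * D\<^sup>2" "(2::real) ^ (2 * s + d) = P\<^sup>2 * D" "(2::real) ^ (2 * s) = P\<^sup>2"
    "(2::real) ^ (s + 2 * d) = P * D\<^sup>2" "(2::real) ^ (s + d) = P * D" "(2::real) ^ (2 * d) = D\<^sup>2"
    "(2::real) ^ (2 * s + 3 * d) = P\<^sup>2 * D ^ 3"
    by (simp_all only: distrib_left power_add two_power_mult P_def D_def)
  have minus1: "(2::real) ^ (2 * (s - d)) = P\<^sup>2 / D\<^sup>2" "(2::real) ^ (3 * s - d) = P ^ 3 / D"
    using d2 by (simp_all add: two_power_mult two_power_diff power_divide P_def D_def)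
  show ?thesis
  proof (intro conjI impI allI ballI)
    show "vec.subspace C" unfolding C by (rule tf.subspace_trace_code)
    show "code_length C = 2 ^ m" by (simp add: code_length_def assms(3))
    show "vec.dim C = 5 * m div 2 + 1" unfolding C tf.dim_trace_code by (simp add: assms(2))
  next
    assume d'_eq: "d' = d"
    let ?K = "{0, d, s}"
    from tf.kdim_image_1[unfolded d d', OF d'_eq] d2
    have K: "finite ?K" "tf.kdim ` tf.P \<subseteq> ?K" "?K \<subseteq> {..s}" by auto
    \<comment> \<open>The three indices are distinct because \<open>0 < d\<close> and
      \<open>2 * d \<le> s\<close>.\<close>
    have sum: "(\<Sum>k\<in>?K. f k) = f 0 + f d + f s" for f :: "nat \<Rightarrow> real"
      using d_pos d2 by simp
    define x y where "x = real (tf.M 0)" and "y = real (tf.M d)"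
    have Ms: "real (tf.M s) = 1" using tf.M_s by simp
    have "x + y + 1 = P ^ 3"
      using tf.sum_M(1)[OF K(1,2)] unfolding sum by (simp add: x_def y_def Ms P_def)
    moreover have "x + D\<^sup>2 * y + P\<^sup>2 = P ^ 3 + (P\<^sup>2 - 1) * (P * D)"
      using tf.sum_M(2)[OF K(1,2)] unfolding sum by (simp add: x_def y_def Ms d P_def D_def mult.commute)
    ultimately have sol: "x = (P - 1) * (P\<^sup>2 * D\<^sup>2 - P\<^sup>2 * D - P\<^sup>2 + P * D\<^sup>2 - P * D + D\<^sup>2) / (D\<^sup>2 - 1)"
      "y = (P * D - 1) * (P\<^sup>2 - 1) / (D\<^sup>2 - 1)"
      "y * (2 * (P\<^sup>2 - P\<^sup>2 / D\<^sup>2)) + 2 * (P\<^sup>2 - 1) = 2 * (P ^ 3 / D - P\<^sup>2 / D\<^sup>2 + 1) * (P\<^sup>2 - 1)"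
      by (rule two_kernel_sizes_solution[OF \<open>D > 1\<close>])+
    show "weight_count C 0 = 1" "weight_count C (2 ^ (2 * s)) = 1" by (rule ends)+
    show "real (weight_count C w) = 2 ^ (2 * s) * (2 ^ s - 1) *
         (2 ^ (2 * (s + d)) - 2 ^ (2 * s + d) - 2 ^ (2 * s) + 2 ^ (s + 2 * d) - 2 ^ (s + d) + 2 ^ (2 * d)) /
         (2 ^ (2 * d) - 1)"
      if "w \<in> {2 ^ (2 * s - 1) - 2 ^ (s - 1), 2 ^ (2 * s - 1) + 2 ^ (s - 1)}" for w
    proof -
      have "real (weight_count C w) = P\<^sup>2 * x"
        using weight[of 0 w] that by (simp add: x_def)
      thus ?thesis unfolding plus P_def[symmetric] by (simp add: sol(1) mult_ac)
    qed
    show "real (weight_count C w) = 2 ^ (2 * (s - d)) * (2 ^ (s + d) - 1) * (2 ^ (2 * s) - 1) / (2 ^ (2 * d) - 1)"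
      if "w \<in> {2 ^ (2 * s - 1) - 2 ^ (s + d - 1), 2 ^ (2 * s - 1) + 2 ^ (s + d - 1)}" for w
    proof -
      have "real (weight_count C w) = P\<^sup>2 / D\<^sup>2 * y"
        using weight[of d w] that d2 by (simp add: y_def D_def)
      thus ?thesis unfolding plus minus1 by (simp add: sol(2) mult_ac)
    qed
    show "real (weight_count C (2 ^ (2 * s - 1))) = 2 * (2 ^ (3 * s - d) - 2 ^ (2 * (s - d)) + 1) * (2 ^ (2 * s) - 1)"
      unfolding plus minus1 sol(3)[symmetric] half_weight[OF K] sum Ms
      using \<open>P > 0\<close> by (simp add: y_def P_def[symmetric] D_def[symmetric])
    show "weight_count C w = 0"
      if w: "w \<notin> {0, 2 ^ (2 * s - 1) - 2 ^ (s - 1), 2 ^ (2 * s - 1) + 2 ^ (s - 1),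
                 2 ^ (2 * s - 1) - 2 ^ (s + d - 1), 2 ^ (2 * s - 1) + 2 ^ (s + d - 1),
                 2 ^ (2 * s - 1), 2 ^ (2 * s)}" for w
    proof -
      have "w \<noteq> 2 ^ (2 * s - 1) - 2 ^ (s + s - 1)"
        unfolding s_weights(1)[symmetric] using w by simp
      moreover have "w \<noteq> 2 ^ (2 * s - 1) + 2 ^ (s + s - 1)"
        unfolding s_weights(2)[symmetric] using w by simp
      ultimately have "w \<noteq> 2 ^ (2 * s - 1) - 2 ^ (s + k - 1) \<and> w \<noteq> 2 ^ (2 * s - 1) + 2 ^ (s + k - 1)"
        if "k \<in> ?K" for k
        using that w by (elim insertE emptyE) (simp_all only: insert_iff de_Morgan_disj add_0_right simp_thms)
      moreover have "w \<noteq> 2 ^ (2 * s - 1)" using w by simp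
      ultimately show ?thesis unfolding C by (intro tf.weight_count_eq_0[OF K(1,2)])
    qed
  next
    assume d'_eq: "d' = 2 * d"
    let ?K = "{0, d, 2 * d, s}"
    have d3: "3 * d \<le> s" using tf.d_triple_le[unfolded d d', OF d'_eq] .
    from tf.kdim_image_2[unfolded d d', OF d'_eq] this
    have K: "finite ?K" "tf.kdim ` tf.P \<subseteq> ?K" "?K \<subseteq> {..s}" by auto
    have sum: "(\<Sum>k\<in>?K. f k) = f 0 + f d + f (2 * d) + f s" for f :: "nat \<Rightarrow> real"
      using d_pos d3 by simp
    define x y z where "x = real (tf.M 0)" and "y = real (tf.M d)" and "z = real (tf.M (2 * d))"
    have Ms: "real (tf.M s) = 1" using tf.M_s by simp
    have D4: "((2::real) ^ (2 * d))\<^sup>2 = D ^ 4" by (simp add: D_def power_mult[symmetric] mult_ac)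
    have "x + y + z + 1 = P ^ 3"
      using tf.sum_M(1)[OF K(1,2)] unfolding sum by (simp add: x_def y_def z_def Ms P_def)
    moreover have "x + D\<^sup>2 * y + D ^ 4 * z + P\<^sup>2 = P ^ 3 + (P\<^sup>2 - 1) * (P * D)"
      using tf.sum_M(2)[OF K(1,2)] unfolding sum D4 by (simp add: x_def y_def z_def Ms d P_def D_def mult.commute)
    moreover have "P\<^sup>2 - P * x + P * D * y - P * D\<^sup>2 * z = P ^ 3"
    proof -
      \<comment> \<open>Hence the zero pair enters the signed equation with the positive term
        \<open>P^2\<close>.\<close>
      have "(- 1 :: real) ^ (s div d) = - 1" using tf.quotients_odd(1)[unfolded d d', OF d'_eq] by simp
      moreover have "(2::real) ^ (s + s) = P\<^sup>2" by (simp add: P_def power_add power2_eq_square)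
      ultimately show ?thesis
        using tf.sum_M_signed[OF K(1,2)[unfolded d], unfolded d d', OF d'_eq] d_pos unfolding sum plus
        by (simp add: x_def y_def z_def Ms P_def[symmetric] algebra_simps)
    qed
    ultimately have sol: "P\<^sup>2 * x = P\<^sup>2 * D ^ 3 * (P - 1) * (P\<^sup>2 - P\<^sup>2 / D\<^sup>2 - P\<^sup>2 / D ^ 3 + P - P / D + 1) / ((D\<^sup>2 - 1) * (D + 1))"
      "P\<^sup>2 / D\<^sup>2 * y = P\<^sup>2 / D * (P\<^sup>2 - 1) * (P + P / D + P / D\<^sup>2 + 1) / (D + 1)\<^sup>2"
      "P\<^sup>2 / D ^ 4 * z = P\<^sup>2 / D ^ 4 * (P / D - 1) * (P\<^sup>2 - 1) / ((D + 1) * (D\<^sup>2 - 1))"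
      "y * (2 * (P\<^sup>2 - P\<^sup>2 / D\<^sup>2)) + z * (2 * (P\<^sup>2 - P\<^sup>2 / D ^ 4)) + 2 * (P\<^sup>2 - 1) =
      2 * (P\<^sup>2 - 1) * (P ^ 3 / D - P ^ 3 / D\<^sup>2 + P ^ 3 / D ^ 3 - P ^ 3 / D ^ 4 + P ^ 3 / D ^ 5
        + P\<^sup>2 / D - 2 * P\<^sup>2 / D\<^sup>2 + P\<^sup>2 / D ^ 3 - P\<^sup>2 / D ^ 4 + 1)"
      using three_kernel_sizes_solution[OF \<open>D > 1\<close> _ _ _ \<open>P > 0\<close>, of x y z] by simp_all
    \<comment> \<open>By \<open>3 * d \<le> s\<close> none of these exponents is a truncated
      difference.\<close>
    have minus2: "(2::real) ^ (2 * s - 3 * d) = P\<^sup>2 / D ^ 3" "(2::real) ^ (s - d) = P / D" "(2::real) ^ (2 * s - d) = P\<^sup>2 / D"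
      "(2::real) ^ (s - 2 * d) = P / D\<^sup>2" "(2::real) ^ (3 * s - 2 * d) = P ^ 3 / D\<^sup>2" "(2::real) ^ (3 * s - 3 * d) = P ^ 3 / D ^ 3"
      "(2::real) ^ (3 * s - 4 * d) = P ^ 3 / D ^ 4" "(2::real) ^ (3 * s - 5 * d) = P ^ 3 / D ^ 5"
      "(2::real) ^ (2 * s - 2 * d + 1) = 2 * P\<^sup>2 / D\<^sup>2" "(2::real) ^ (2 * s - 4 * d) = P\<^sup>2 / D ^ 4"
      using d3 by (simp_all add: two_power_mult two_power_diff P_def D_def)
    show "weight_count C 0 = 1" "weight_count C (2 ^ (2 * s)) = 1" by (rule ends)+
    show "real (weight_count C w) = 2 ^ (2 * s + 3 * d) * (2 ^ s - 1) *
         (2 ^ (2 * s) - 2 ^ (2 * (s - d)) - 2 ^ (2 * s - 3 * d) + 2 ^ s - 2 ^ (s - d) + 1) /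
         ((2 ^ (2 * d) - 1) * (2 ^ d + 1))"
      if "w \<in> {2 ^ (2 * s - 1) - 2 ^ (s - 1), 2 ^ (2 * s - 1) + 2 ^ (s - 1)}" for w
    proof -
      have "real (weight_count C w) = P\<^sup>2 * x"
        using weight[of 0 w] that by (simp add: x_def)
      thus ?thesis unfolding plus minus1 minus2 P_def[symmetric] D_def[symmetric] sol(1) .
    qed
    show "real (weight_count C w) =
         2 ^ (2 * s - d) * (2 ^ (2 * s) - 1) * (2 ^ s + 2 ^ (s - d) + 2 ^ (s - 2 * d) + 1) / (2 ^ d + 1) ^ 2"
      if "w \<in> {2 ^ (2 * s - 1) - 2 ^ (s + d - 1), 2 ^ (2 * s - 1) + 2 ^ (s + d - 1)}" for w
    proof -
      have "real (weight_count C w) = P\<^sup>2 / D\<^sup>2 * y"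
        using weight[of d w] that d2 by (simp add: y_def D_def)
      thus ?thesis unfolding plus minus2 P_def[symmetric] D_def[symmetric] sol(2) .
    qed
    show "real (weight_count C (2 ^ (2 * s - 1))) = 2 * (2 ^ (2 * s) - 1) *
        (2 ^ (3 * s - d) - 2 ^ (3 * s - 2 * d) + 2 ^ (3 * s - 3 * d) - 2 ^ (3 * s-4 * d) + 2 ^ (3 * s-5 * d)
         + 2 ^ (2 * s - d) - 2 ^ (2 * s - 2 * d + 1) + 2 ^ (2 * s - 3 * d) - 2 ^ (2 * s-4 * d) + 1)"
      unfolding plus minus1 minus2 sol(4)[symmetric] half_weight[OF K] sum Ms D4
      using \<open>P > 0\<close> by (simp add: y_def z_def P_def[symmetric] D_def[symmetric])
    show "real (weight_count C w) =
         2 ^ (2 * s-4 * d) * (2 ^ (s - d) - 1) * (2 ^ (2 * s) - 1) / ((2 ^ d + 1) * (2 ^ (2 * d) - 1))"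
      if "w \<in> {2 ^ (2 * s - 1) - 2 ^ (s + 2 * d - 1), 2 ^ (2 * s - 1) + 2 ^ (s + 2 * d - 1)}" for w
    proof -
      have "real (weight_count C w) = P\<^sup>2 / D ^ 4 * z"
        using weight[of "2 * d" w] that d2 unfolding D4 by (simp add: z_def)
      thus ?thesis unfolding plus minus2 D_def[symmetric] sol(3) .
    qed
    show "weight_count C w = 0"
      if w: "w \<notin> {0, 2 ^ (2 * s - 1) - 2 ^ (s - 1), 2 ^ (2 * s - 1) + 2 ^ (s - 1),
                 2 ^ (2 * s - 1) - 2 ^ (s + d - 1), 2 ^ (2 * s - 1) + 2 ^ (s + d - 1),
                 2 ^ (2 * s - 1),
                 2 ^ (2 * s - 1) - 2 ^ (s + 2 * d - 1), 2 ^ (2 * s - 1) + 2 ^ (s + 2 * d - 1), 2 ^ (2 * s)}" for w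
    proof -
      have "w \<noteq> 2 ^ (2 * s - 1) - 2 ^ (s + s - 1)"
        unfolding s_weights(1)[symmetric] using w by simp
      moreover have "w \<noteq> 2 ^ (2 * s - 1) + 2 ^ (s + s - 1)"
        unfolding s_weights(2)[symmetric] using w by simp
      ultimately have "w \<noteq> 2 ^ (2 * s - 1) - 2 ^ (s + k - 1) \<and> w \<noteq> 2 ^ (2 * s - 1) + 2 ^ (s + k - 1)"
        if "k \<in> ?K" for k
        using that w by (elim insertE emptyE) (simp_all only: insert_iff de_Morgan_disj add_0_right simp_thms)
      moreover have "w \<noteq> 2 ^ (2 * s - 1)" using w by simp
      ultimately show ?thesis unfolding C by (intro tf.weight_count_eq_0[OF K(1,2)])
    qed
  qed
qed

end
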